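(* Let $X$ be a geodesically complete proper CAT(0) space, $G<\mathrm{Is}(X)$ a closed totally disconnected subgroup and $\xi\in\partial X$. If the stabiliser $G_\xi$ acts cocompactly on $X$, then the $G$-orbit of $\xi$ is discrete in the Tits topology.
   Context: A metric space is proper if all its closed balls are compact. $\mathrm{Is}(X)$ is the full isometry group with the topology of uniform convergence on compacta. A CAT(0) space is geodesically complete if every geodesic segment of positive length can be extended to a bi-infinite geodesic line. A group acts cocompactly on $X$ if the translates of some compact set cover $X$. The Tits topology on the boundary at infinity $\partial X$ is the one defined by the Tits angle $\angle_{\mathrm T}(\xi,\eta)=\sup_{p\in X}\angle_p(\xi,\eta)$, where $\angle_p(\xi,\eta)$ is the Alexandrov angle at $p$ between the geodesic rays from $p$ to $\xi$ and $\eta$. *)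

theory Defs
  imports "HOL-Analysis.Analysis" "HOL-Algebra.Group_Action"
begin

text \<open>The space \<open>X\<close> is the type \<open>'a::metric_space\<close>; properties of the whole space are
  predicates on \<^term>\<open>TYPE('a)\<close>.\<close>

section \<open>Proper geodesically complete CAT(0) spaces\<close>

definition proper_space :: "'a::metric_space itself \<Rightarrow> bool" where
  "proper_space _ \<longleftrightarrow> (\<forall>(x::'a) r. compact (cball x r))"

definition geodesic_on :: "real set \<Rightarrow> (real \<Rightarrow> 'a::metric_space) \<Rightarrow> bool" where
  "geodesic_on I c \<longleftrightarrow> (\<forall>s\<in>I. \<forall>t\<in>I. dist (c s) (c t) = \<bar>s - t\<bar>)"

definition geodesic_from_to :: "(real \<Rightarrow> 'a::metric_space) \<Rightarrow> 'a \<Rightarrow> 'a \<Rightarrow> bool" where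
  "geodesic_from_to c x y \<longleftrightarrow>
     geodesic_on {0..dist x y} c \<and> c 0 = x \<and> c (dist x y) = y"

definition geodesic_space :: "'a::metric_space itself \<Rightarrow> bool" where
  "geodesic_space _ \<longleftrightarrow> (\<forall>x y::'a. \<exists>c. geodesic_from_to c x y)"

text \<open>Pairs of a point \<open>p\<close> on the side \<open>c\<close> from \<open>x\<close> to \<open>y\<close> and its comparison point \<open>p'\<close> on the
  side \<open>[x', y']\<close> of a comparison triangle.\<close>

definition comparison_pairs ::
    "(real \<Rightarrow> 'a::metric_space) \<Rightarrow> 'a \<Rightarrow> 'a \<Rightarrow> real^2 \<Rightarrow> real^2 \<Rightarrow> ('a \<times> (real^2)) set" where
  "comparison_pairs c x y x' y' =
     {(p, p'). p \<in> c ` {0..dist x y} \<and> p' \<in> closed_segment x' y' \<and> dist x' p' = dist x p}"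

definition CAT0_space :: "'a::metric_space itself \<Rightarrow> bool" where
  "CAT0_space _ \<longleftrightarrow> geodesic_space TYPE('a) \<and>
     (\<forall>(x::'a) y z c1 c2 c3 x' y' z'.
        geodesic_from_to c1 x y \<and> geodesic_from_to c2 y z \<and> geodesic_from_to c3 z x \<and>
        dist x' y' = dist x y \<and> dist y' z' = dist y z \<and> dist z' x' = dist z x \<longrightarrow>
        (let R = comparison_pairs c1 x y x' y' \<union> comparison_pairs c2 y z y' z'
                 \<union> comparison_pairs c3 z x z' x'
         in \<forall>(p, p')\<in>R. \<forall>(q, q')\<in>R. dist p q \<le> dist p' q'))"

definition geodesically_complete :: "'a::metric_space itself \<Rightarrow> bool" where
  "geodesically_complete _ \<longleftrightarrow>
     (\<forall>(x::'a) y c. x \<noteq> y \<and> geodesic_from_to c x y \<longrightarrow>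
        (\<exists>l. geodesic_on UNIV l \<and> (\<forall>t\<in>{0..dist x y}. l t = c t)))"

section \<open>The isometry group\<close>

definition isometry_group :: "('a::metric_space \<Rightarrow> 'a) monoid" where
  "isometry_group =
     \<lparr>carrier = {g. bij g \<and> (\<forall>x y. dist (g x) (g y) = dist x y)}, mult = (\<circ>), one = id\<rparr>"

lemma group_isometry_group: "group (isometry_group :: ('a::metric_space \<Rightarrow> 'a) monoid)"
proof (rule groupI)
  fix g :: "'a \<Rightarrow> 'a"
  assume "g \<in> carrier isometry_group"
  then have g: "bij g" "\<And>x y. dist (g x) (g y) = dist x y"
    by (auto simp: isometry_group_def)
  have "dist (inv_into UNIV g x) (inv_into UNIV g y) = dist x y" for x y
    using g(2)[of "inv_into UNIV g x" "inv_into UNIV g y"] g(1)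
    by (simp add: bij_is_surj surj_f_inv_f)
  moreover have "inv_into UNIV g \<circ> g = id"
    using g(1) by (simp add: bij_is_inj)
  ultimately show "\<exists>h\<in>carrier isometry_group. h \<otimes>\<^bsub>isometry_group\<^esub> g = \<one>\<^bsub>isometry_group\<^esub>"
    using g(1) by (intro bexI[of _ "inv_into UNIV g"]) (auto simp: isometry_group_def bij_imp_bij_inv)
qed (auto simp: isometry_group_def bij_comp o_assoc)

text \<open>The topology of uniform convergence on compacta.\<close>

definition isometry_topology :: "('a::metric_space \<Rightarrow> 'a) topology" where
  "isometry_topology = topology (\<lambda>U. U \<subseteq> carrier isometry_group \<and>
     (\<forall>g\<in>U. \<exists>K e. compact K \<and> e > 0 \<and>
        (\<forall>h\<in>carrier isometry_group. (\<forall>x\<in>K. dist (g x) (h x) < e) \<longrightarrow> h \<in> U)))"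

lemma openin_isometry_topology:
  "openin isometry_topology U \<longleftrightarrow> U \<subseteq> carrier isometry_group \<and>
     (\<forall>g\<in>U. \<exists>K e. compact K \<and> e > 0 \<and>
        (\<forall>h\<in>carrier isometry_group. (\<forall>x\<in>K. dist (g x) (h x) < e) \<longrightarrow> h \<in> U))"
proof -
  define nb :: "('a \<Rightarrow> 'a) \<Rightarrow> ('a \<Rightarrow> 'a) set \<Rightarrow> bool" where
    "nb g U \<longleftrightarrow> (\<exists>K e. compact K \<and> e > 0 \<and>
        (\<forall>h\<in>carrier isometry_group. (\<forall>x\<in>K. dist (g x) (h x) < e) \<longrightarrow> h \<in> U))" for g U
  have mono: "nb g V" if "nb g U" "U \<subseteq> V" for g U V
    using that unfolding nb_def by (meson subsetD)
  have int: "nb g (U \<inter> V)" if U: "nb g U" and V: "nb g V" for g U V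
  proof -
    obtain K e where K: "compact K" "e > 0"
      "\<And>h. \<lbrakk>h\<in>carrier isometry_group; \<forall>x\<in>K. dist (g x) (h x) < e\<rbrakk> \<Longrightarrow> h \<in> U"
      using U unfolding nb_def by blast
    obtain L d where L: "compact L" "d > 0"
      "\<And>h. \<lbrakk>h\<in>carrier isometry_group; \<forall>x\<in>L. dist (g x) (h x) < d\<rbrakk> \<Longrightarrow> h \<in> V"
      using V unfolding nb_def by blast
    show ?thesis
      unfolding nb_def
      using K L by (intro exI[of _ "K \<union> L"] exI[of _ "min e d"]) auto
  qed
  have "istopology (\<lambda>U. U \<subseteq> carrier isometry_group \<and> (\<forall>g\<in>U. nb g U))"
    unfolding istopology_def
  proof (intro conjI allI impI)
    fix \<U> :: "('a \<Rightarrow> 'a) set set"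
    assume "\<forall>U\<in>\<U>. U \<subseteq> carrier isometry_group \<and> (\<forall>g\<in>U. nb g U)"
    then show "\<Union>\<U> \<subseteq> carrier isometry_group" "\<forall>g\<in>\<Union>\<U>. nb g (\<Union>\<U>)"
      by (blast, meson Union_iff Union_upper mono)
  qed (use int in blast)+
  then show ?thesis
    unfolding isometry_topology_def nb_def by (simp add: topology_inverse')
qed

definition totally_disconnected :: "'b topology \<Rightarrow> bool" where
  "totally_disconnected T \<longleftrightarrow> (\<forall>x\<in>topspace T. connected_component_of_set T x = {x})"

definition acts_cocompactly :: "('a::metric_space \<Rightarrow> 'a) set \<Rightarrow> bool" where
  "acts_cocompactly H \<longleftrightarrow> (\<exists>K. compact K \<and> (\<Union>g\<in>H. g ` K) = UNIV)"

section \<open>The boundary at infinity\<close>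

text \<open>Rays are total functions on the reals whose values at negative arguments are irrelevant:
  two functions agreeing on \<^term>\<open>{0::real..}\<close> are asymptotic, so they define the same boundary
  point.\<close>

definition geodesic_rays :: "(real \<Rightarrow> 'a::metric_space) set" where
  "geodesic_rays = {c. geodesic_on {0..} c}"

definition asymptotic :: "((real \<Rightarrow> 'a::metric_space) \<times> (real \<Rightarrow> 'a)) set" where
  "asymptotic = {(c, c'). c \<in> geodesic_rays \<and> c' \<in> geodesic_rays \<and>
                          (\<exists>C. \<forall>t\<ge>0. dist (c t) (c' t) \<le> C)}"

definition boundary :: "(real \<Rightarrow> 'a::metric_space) set set" where
  "boundary = geodesic_rays // asymptotic"

text \<open>An isometry \<open>g\<close> sends the class of \<open>c\<close> to the class of \<open>g \<circ> c\<close>; for bijective \<open>g\<close> the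
  image below is the whole class.\<close>

definition boundary_action :: "('a::metric_space \<Rightarrow> 'a) \<Rightarrow> (real \<Rightarrow> 'a) set \<Rightarrow> (real \<Rightarrow> 'a) set"
  where "boundary_action g \<xi> = (\<lambda>c. g \<circ> c) ` \<xi>"

section \<open>Angles and the Tits topology\<close>

text \<open>The angle at the vertex corresponding to \<open>p\<close> of a Euclidean comparison triangle for
  \<open>p, x, y\<close>, given by the law of cosines; meaningful for \<open>x \<noteq> p\<close> and \<open>y \<noteq> p\<close>.\<close>

definition comparison_angle :: "'a::metric_space \<Rightarrow> 'a \<Rightarrow> 'a \<Rightarrow> real" where
  "comparison_angle p x y =
     arccos (((dist p x)\<^sup>2 + (dist p y)\<^sup>2 - (dist x y)\<^sup>2) / (2 * dist p x * dist p y))"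

text \<open>For geodesics \<open>c\<close>, \<open>c'\<close> issuing from the same point. The upper limit is taken as both
  parameters tend to 0 independently; it lies between 0 and \<open>pi\<close>.\<close>

definition alexandrov_angle ::
    "(real \<Rightarrow> 'a::metric_space) \<Rightarrow> (real \<Rightarrow> 'a) \<Rightarrow> real" where
  "alexandrov_angle c c' =
     real_of_ereal (Limsup (at_right 0 \<times>\<^sub>F at_right 0)
       (\<lambda>(s, t). ereal (comparison_angle (c 0) (c s) (c' t))))"

text \<open>In a complete CAT(0) space there is exactly one ray from \<open>p\<close> to \<open>\<xi>\<close>, so that the choice
  below only affects irrelevant values at negative arguments.\<close>

definition ray_from_to :: "'a::metric_space \<Rightarrow> (real \<Rightarrow> 'a) set \<Rightarrow> real \<Rightarrow> 'a" where
  "ray_from_to p \<xi> = (SOME c. c \<in> \<xi> \<and> c 0 = p)"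

definition angle_at :: "'a::metric_space \<Rightarrow> (real \<Rightarrow> 'a) set \<Rightarrow> (real \<Rightarrow> 'a) set \<Rightarrow> real" where
  "angle_at p \<xi> \<eta> = alexandrov_angle (ray_from_to p \<xi>) (ray_from_to p \<eta>)"

definition tits_angle :: "(real \<Rightarrow> 'a::metric_space) set \<Rightarrow> (real \<Rightarrow> 'a) set \<Rightarrow> real" where
  "tits_angle \<xi> \<eta> = (SUP p. angle_at p \<xi> \<eta>)"

definition tits_topology :: "(real \<Rightarrow> 'a::metric_space) set topology" where
  "tits_topology = topology (\<lambda>U. U \<subseteq> boundary \<and>
     (\<forall>\<xi>\<in>U. \<exists>e>0. \<forall>\<eta>\<in>boundary. tits_angle \<xi> \<eta> < e \<longrightarrow> \<eta> \<in> U))"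

lemma openin_tits_topology:
  "openin tits_topology U \<longleftrightarrow> U \<subseteq> boundary \<and>
     (\<forall>\<xi>\<in>U. \<exists>e>0. \<forall>\<eta>\<in>boundary. tits_angle \<xi> \<eta> < e \<longrightarrow> \<eta> \<in> U)"
proof -
  define nb :: "(real \<Rightarrow> 'a) set \<Rightarrow> (real \<Rightarrow> 'a) set set \<Rightarrow> bool" where
    "nb \<xi> U \<longleftrightarrow> (\<exists>e>0. \<forall>\<eta>\<in>boundary. tits_angle \<xi> \<eta> < e \<longrightarrow> \<eta> \<in> U)" for \<xi> U
  have mono: "nb \<xi> V" if "nb \<xi> U" "U \<subseteq> V" for \<xi> U V
    using that unfolding nb_def by (meson subsetD)
  have int: "nb \<xi> (U \<inter> V)" if "nb \<xi> U" "nb \<xi> V" for \<xi> U V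
  proof -
    obtain e where "e > 0" "\<And>\<eta>. \<lbrakk>\<eta>\<in>boundary; tits_angle \<xi> \<eta> < e\<rbrakk> \<Longrightarrow> \<eta> \<in> U"
      using \<open>nb \<xi> U\<close> unfolding nb_def by blast
    moreover obtain d where "d > 0" "\<And>\<eta>. \<lbrakk>\<eta>\<in>boundary; tits_angle \<xi> \<eta> < d\<rbrakk> \<Longrightarrow> \<eta> \<in> V"
      using \<open>nb \<xi> V\<close> unfolding nb_def by blast
    ultimately show ?thesis
      unfolding nb_def by (intro exI[of _ "min e d"]) auto
  qed
  have "istopology (\<lambda>U. U \<subseteq> boundary \<and> (\<forall>\<xi>\<in>U. nb \<xi> U))"
    unfolding istopology_def
  proof (intro conjI allI impI)
    fix \<U> :: "(real \<Rightarrow> 'a) set set set"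
    assume "\<forall>U\<in>\<U>. U \<subseteq> boundary \<and> (\<forall>\<xi>\<in>U. nb \<xi> U)"
    then show "\<Union>\<U> \<subseteq> boundary" "\<forall>\<xi>\<in>\<Union>\<U>. nb \<xi> (\<Union>\<U>)"
      by (blast, meson Union_iff Union_upper mono)
  qed (use int in blast)+
  then show ?thesis
    unfolding tits_topology_def nb_def by (simp add: topology_inverse')
qed

end

theory Submission
  imports Defs
begin

text \<open>A group of isometries that moves every point of a ball only slightly has almost dense fixed points
  there (circumcentres of orbits), and by geodesic completeness it fixes a slightly smaller ball
  pointwise. Since \<open>G\<close> is totally disconnected, it has small open subgroups, so the pointwise
  stabiliser in \<open>G\<close> of every ball is open: elements of \<open>G\<close> converging to \<open>g\<close> eventually agree with
  \<open>g\<close> on any given ball. Therefore angles at a fixed point become stationary along such sequences,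
  and a Tits limit of orbit points \<open>g\<^sub>n\<xi>\<close> with \<open>g\<^sub>n\<close> bounded, which cocompactness of \<open>G\<^sub>\<xi>\<close> allows to
  assume, lies in the orbit. If orbit points other than \<open>\<xi>\<close> accumulated at \<open>\<xi>\<close>, then there would be
  \<open>h\<close> in \<open>G\<close> with \<open>h\<xi>\<close> arbitrarily close to \<open>\<xi>\<close> that agree with the identity on an initial segment of
  a ray to \<open>\<xi>\<close> and not beyond; moving the branch point into a compact set by \<open>G\<^sub>\<xi>\<close> and passing to the
  limit once more gives some \<open>g\<close> in \<open>G\<^sub>\<xi>\<close> that agrees with such an \<open>h\<close> near the branch point. But
  \<open>g\<close> fixes the ray from the branch point to \<open>\<xi>\<close>, a contradiction.\<close>

section \<open>Comparison triangles and convexity of the metric\<close>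

lemma geodesic_from_toD:
  assumes "geodesic_from_to c x y" "0 \<le> s" "s \<le> dist x y" "0 \<le> t" "t \<le> dist x y"
  shows "dist (c s) (c t) = \<bar>s - t\<bar>"
  using assms by (auto simp: geodesic_from_to_def geodesic_on_def)

lemma geodesic_from_to_ends:
  assumes "geodesic_from_to c x y" shows "c 0 = x" "c (dist x y) = y"
  using assms by (auto simp: geodesic_from_to_def)

lemma geodesic_from_to_reverse:
  assumes "geodesic_from_to c x y"
  shows "geodesic_from_to (\<lambda>t. c (dist x y - t)) y x"
  using assms by (auto simp: geodesic_from_to_def geodesic_on_def dist_commute)

lemma geodesic_from_to_subpath:
  assumes "geodesic_on I c" "a \<le> b" "{a..b} \<subseteq> I"
  shows "geodesic_from_to (\<lambda>t. c (a + t)) (c a) (c b)" "dist (c a) (c b) = b - a"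
proof -
  show d: "dist (c a) (c b) = b - a"
    using assms by (auto simp: geodesic_on_def subset_iff)
  show "geodesic_from_to (\<lambda>t. c (a + t)) (c a) (c b)"
    using assms by (auto simp: d geodesic_from_to_def geodesic_on_def subset_iff)
qed

lemma dist_vector_2:
  "dist (vector [u, v] :: real^2) (vector [u', v']) = sqrt ((u - u')\<^sup>2 + (v - v')\<^sup>2)"
  by (simp add: dist_vec_def L2_set_def sum_2 vector_2 dist_real_def)

text \<open>Put \<open>x'\<close> at the origin and \<open>y'\<close> on the first axis. The law of
  cosines forces the first coordinate \<open>u\<close> of \<open>z'\<close>, and the triangle
  inequalities bound its absolute value by \<open>b\<close>, so the second coordinate
  exists.\<close>

lemma ex_comparison_triangle:
  fixes x y z :: "'a::metric_space"
  obtains x' y' z' :: "real^2"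
  where "dist x' y' = dist x y" "dist y' z' = dist y z" "dist z' x' = dist z x"
proof (cases "x = y")
  case True
  show ?thesis
    by (rule that[of "vector [0,0]" "vector [0,0]" "vector [dist z x,0]"])
      (simp_all add: True dist_vector_2 dist_commute)
next
  case False
  define a b c where "a = dist x y" and "b = dist z x" and "c = dist y z"
  define u where "u = (a\<^sup>2 + b\<^sup>2 - c\<^sup>2) / (2 * a)"
  have a: "a > 0" and b: "b \<ge> 0" and c: "c \<ge> 0"
    using False by (auto simp: a_def b_def c_def)
  have tri: "c \<le> a + b" "a \<le> b + c" "b \<le> a + c"
    unfolding a_def b_def c_def by metric+
  have "(a - b)\<^sup>2 \<le> c\<^sup>2" "c\<^sup>2 \<le> (a + b)\<^sup>2"
    using tri a b c by (auto intro!: power_mono simp: abs_le_square_iff[symmetric])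
  then have "\<bar>a\<^sup>2 + b\<^sup>2 - c\<^sup>2\<bar> \<le> 2 * a * b"
    by (auto simp: abs_le_iff power2_eq_square algebra_simps)
  then have "\<bar>u\<bar> \<le> b"
    using a by (simp add: u_def abs_divide divide_le_eq mult_ac)
  then have u: "u\<^sup>2 \<le> b\<^sup>2"
    using b by (simp add: abs_le_square_iff[symmetric])
  have "(a - u)\<^sup>2 + (b\<^sup>2 - u\<^sup>2) = c\<^sup>2"
    using a by (simp add: u_def power2_diff field_simps power2_eq_square)
  then show ?thesis
    using u a b c
    by (intro that[of "vector [0,0]" "vector [a,0]" "vector [u, sqrt (b\<^sup>2 - u\<^sup>2)]"])
      (simp_all add: dist_vector_2 flip: a_def b_def c_def)
qed

lemma CAT0_geodesic:
  fixes x y :: "'a::metric_space"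
  assumes "CAT0_space TYPE('a)"
  obtains c where "geodesic_from_to c x y"
  using assms unfolding CAT0_space_def geodesic_space_def by blast

lemma CAT0_comparison:
  fixes x y z :: "'a::metric_space" and x' y' z' :: "real^2"
  assumes "CAT0_space TYPE('a)"
    and "geodesic_from_to c1 x y" "geodesic_from_to c2 y z" "geodesic_from_to c3 z x"
    and "dist x' y' = dist x y" "dist y' z' = dist y z" "dist z' x' = dist z x"
    and "(p, p') \<in> comparison_pairs c1 x y x' y' \<union> comparison_pairs c2 y z y' z'
                 \<union> comparison_pairs c3 z x z' x'"
    and "(q, q') \<in> comparison_pairs c1 x y x' y' \<union> comparison_pairs c2 y z y' z'
                 \<union> comparison_pairs c3 z x z' x'"
  shows "dist p q \<le> dist p' q'"
proof -
  have "\<forall>(p, p')\<in>comparison_pairs c1 x y x' y' \<union> comparison_pairs c2 y z y' z'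
                 \<union> comparison_pairs c3 z x z' x'.
        \<forall>(q, q')\<in>comparison_pairs c1 x y x' y' \<union> comparison_pairs c2 y z y' z'
                 \<union> comparison_pairs c3 z x z' x'. dist p q \<le> dist p' q'"
    using assms(1)[unfolded CAT0_space_def Let_def] assms(2-7) by blast
  then show ?thesis
    using assms(8,9) by blast
qed

lemma comparison_pairsI:
  assumes c: "geodesic_from_to c x y" and d: "dist x' y' = dist x y" and s: "0 \<le> s" "s \<le> 1"
  shows "(c (s * dist x y), x' + s *\<^sub>R (y' - x')) \<in> comparison_pairs c x y x' y'"
proof -
  have le: "s * dist x y \<le> dist x y"
    using s by (simp add: mult_left_le_one_le)
  have "dist x' (x' + s *\<^sub>R (y' - x')) = s * dist x y"
    using s d by (simp add: dist_norm norm_minus_commute)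
  moreover have "dist x (c (s * dist x y)) = s * dist x y"
    using geodesic_from_toD[OF c, of 0 "s * dist x y"] geodesic_from_to_ends[OF c] s le by simp
  moreover have "x' + s *\<^sub>R (y' - x') \<in> closed_segment x' y'"
    using s by (auto simp: closed_segment_def algebra_simps intro!: exI[of _ s])
  ultimately show ?thesis
    using s le by (auto simp: comparison_pairs_def)
qed

text \<open>In the Euclidean comparison triangle the points at fraction \<open>s\<close> of the two
  sides issuing from \<open>x'\<close> are exactly \<open>s * dist y z\<close> apart.\<close>

lemma CAT0_fork:
  fixes x y z :: "'a::metric_space"
  assumes cat: "CAT0_space TYPE('a)"
    and c1: "geodesic_from_to c1 x y" and c2: "geodesic_from_to c2 x z"
    and s: "0 \<le> s" "s \<le> 1"
  shows "dist (c1 (s * dist x y)) (c2 (s * dist x z)) \<le> s * dist y z"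
proof -
  obtain c where c: "geodesic_from_to c y z"
    using CAT0_geodesic[OF cat] .
  define c3 where "c3 = (\<lambda>t. c2 (dist x z - t))"
  have c3: "geodesic_from_to c3 z x"
    unfolding c3_def by (rule geodesic_from_to_reverse[OF c2])
  obtain x' y' z' :: "real^2"
    where d: "dist x' y' = dist x y" "dist y' z' = dist y z" "dist z' x' = dist z x"
    using ex_comparison_triangle .
  \<comment> \<open>A triangle is traversed cyclically, its third side running from \<open>z\<close>
    to \<open>x\<close>, so fraction \<open>s\<close> of \<open>c2\<close> is fraction
    \<open>1 - s\<close> of \<open>c3\<close>.\<close>
  have e: "c3 ((1 - s) * dist z x) = c2 (s * dist x z)"
    by (simp add: c3_def dist_commute algebra_simps)
  have "(c1 (s * dist x y), x' + s *\<^sub>R (y' - x')) \<in> comparison_pairs c1 x y x' y'"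
    by (rule comparison_pairsI[OF c1 d(1) s])
  moreover have "(c2 (s * dist x z), z' + (1 - s) *\<^sub>R (x' - z')) \<in> comparison_pairs c3 z x z' x'"
    using comparison_pairsI[OF c3 d(3), of "1 - s"] s e by simp
  ultimately have "dist (c1 (s * dist x y)) (c2 (s * dist x z))
      \<le> dist (x' + s *\<^sub>R (y' - x')) (z' + (1 - s) *\<^sub>R (x' - z'))"
    by (intro CAT0_comparison[OF cat c1 c c3 d]) auto
  also have "\<dots> = norm (s *\<^sub>R (y' - z'))"
    by (simp add: dist_norm algebra_simps)
  also have "\<dots> = s * dist y z"
    using s d by (simp add: dist_norm)
  finally show ?thesis .
qed

text \<open>A fork whose prongs end at the same point has an opposite side of length 0.\<close>

lemma CAT0_unique_geodesic:
  fixes x y :: "'a::metric_space"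
  assumes cat: "CAT0_space TYPE('a)"
    and c1: "geodesic_from_to c1 x y" and c2: "geodesic_from_to c2 x y"
    and t: "0 \<le> t" "t \<le> dist x y"
  shows "c1 t = c2 t"
proof (cases "x = y")
  case True
  then show ?thesis
    using t geodesic_from_to_ends[OF c1] geodesic_from_to_ends[OF c2] by auto
next
  case False
  then show ?thesis
    using CAT0_fork[OF cat c1 c2, of "t / dist x y"] t by (simp add: divide_le_eq)
qed

text \<open>The diagonal \<open>e\<close> from \<open>x\<close> to \<open>y'\<close> cuts the
  quadrilateral into two forks, one at \<open>x\<close> and, after reversing the geodesics, one at
  \<open>y'\<close>.\<close>

lemma CAT0_convex:
  fixes x y x' y' :: "'a::metric_space"
  assumes cat: "CAT0_space TYPE('a)"
    and c: "geodesic_from_to c x y" and c': "geodesic_from_to c' x' y'"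
    and s: "0 \<le> s" "s \<le> 1"
  shows "dist (c (s * dist x y)) (c' (s * dist x' y')) \<le> (1 - s) * dist x x' + s * dist y y'"
proof -
  obtain e where e: "geodesic_from_to e x y'"
    using CAT0_geodesic[OF cat] .
  have "dist (c (s * dist x y)) (e (s * dist x y')) \<le> s * dist y y'"
    by (rule CAT0_fork[OF cat c e s])
  moreover have "dist (e (s * dist x y')) (c' (s * dist x' y')) \<le> (1 - s) * dist x x'"
    using CAT0_fork[OF cat geodesic_from_to_reverse[OF e] geodesic_from_to_reverse[OF c'], of "1 - s"] s
    by (simp add: dist_commute algebra_simps)
  ultimately show ?thesis
    using dist_triangle[of "c (s * dist x y)" "c' (s * dist x' y')" "e (s * dist x y')"] by linarith
qed

text \<open>The Bruhat-Tits (CN) inequality, with \<open>m\<close> the midpoint of \<open>y\<close>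
  and \<open>z\<close>. The right-hand side is the squared length of a median in the Euclidean
  comparison triangle.\<close>

lemma CAT0_midpoint:
  fixes y z :: "'a::metric_space"
  assumes cat: "CAT0_space TYPE('a)"
  obtains m where "\<And>x. (dist x m)\<^sup>2 \<le> ((dist x y)\<^sup>2 + (dist x z)\<^sup>2) / 2 - (dist y z)\<^sup>2 / 4"
proof -
  obtain c where c: "geodesic_from_to c y z"
    using CAT0_geodesic[OF cat] .
  have "(dist x (c (1/2 * dist y z)))\<^sup>2 \<le> ((dist x y)\<^sup>2 + (dist x z)\<^sup>2) / 2 - (dist y z)\<^sup>2 / 4" for x
  proof -
    obtain c1 c3 where c1: "geodesic_from_to c1 x y" and c3: "geodesic_from_to c3 z x"
      using CAT0_geodesic[OF cat] by metis
    obtain x' y' z' :: "real^2"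
      where d: "dist x' y' = dist x y" "dist y' z' = dist y z" "dist z' x' = dist z x"
      using ex_comparison_triangle .
    have "(x, x') \<in> comparison_pairs c1 x y x' y'"
      using comparison_pairsI[OF c1 d(1), of 0] geodesic_from_to_ends[OF c1] by simp
    moreover have "(c (1/2 * dist y z), y' + (1/2) *\<^sub>R (z' - y')) \<in> comparison_pairs c y z y' z'"
      by (rule comparison_pairsI[OF c d(2)]) auto
    ultimately have "dist x (c (1/2 * dist y z)) \<le> dist x' (y' + (1/2) *\<^sub>R (z' - y'))"
      by (intro CAT0_comparison[OF cat c1 c c3 d]) auto
    then have "(dist x (c (1/2 * dist y z)))\<^sup>2 \<le> (dist x' (y' + (1/2) *\<^sub>R (z' - y')))\<^sup>2"
      by (simp add: power_mono)
    also have "\<dots> = ((dist x' y')\<^sup>2 + (dist z' x')\<^sup>2) / 2 - (dist y' z')\<^sup>2 / 4"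
      unfolding dist_norm power2_norm_eq_inner
      by (simp add: inner_diff_left inner_diff_right inner_add_left inner_add_right inner_commute field_simps)
    finally show ?thesis
      using d by (simp add: dist_commute)
  qed
  then show ?thesis
    by (rule that)
qed

section \<open>Geodesic rays and the boundary\<close>

lemma geodesic_raysD:
  "c \<in> geodesic_rays \<Longrightarrow> 0 \<le> s \<Longrightarrow> 0 \<le> t \<Longrightarrow> dist (c s) (c t) = \<bar>s - t\<bar>"
  by (auto simp: geodesic_rays_def geodesic_on_def)

lemma geodesic_raysI:
  "(\<And>s t. 0 \<le> s \<Longrightarrow> 0 \<le> t \<Longrightarrow> dist (c s) (c t) = \<bar>s - t\<bar>) \<Longrightarrow> c \<in> geodesic_rays"
  by (auto simp: geodesic_rays_def geodesic_on_def)

lemma geodesic_rays_shift: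
  assumes "c \<in> geodesic_rays" "0 \<le> a"
  shows "(\<lambda>t. c (a + t)) \<in> geodesic_rays"
  using assms by (intro geodesic_raysI) (simp add: geodesic_raysD)

lemma CAT0_rays_convex:
  fixes c c' :: "real \<Rightarrow> 'a::metric_space"
  assumes cat: "CAT0_space TYPE('a)" and c: "c \<in> geodesic_rays" and c': "c' \<in> geodesic_rays"
    and ab: "0 \<le> a" "0 \<le> b" and s: "0 \<le> s" "s \<le> 1"
  shows "dist (c (s * a)) (c' (s * b)) \<le> (1 - s) * dist (c 0) (c' 0) + s * dist (c a) (c' b)"
proof -
  have *: "geodesic_on {0..} c" "geodesic_on {0..} c'"
    using c c' by (auto simp: geodesic_rays_def)
  show ?thesis
    using CAT0_convex[OF cat geodesic_from_to_subpath(1)[OF *(1) ab(1)]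
        geodesic_from_to_subpath(1)[OF *(2) ab(2)] s]
      geodesic_from_to_subpath(2)[OF *(1) ab(1)] geodesic_from_to_subpath(2)[OF *(2) ab(2)]
    by (simp add: subset_iff)
qed

lemma equiv_asymptotic: "equiv geodesic_rays (asymptotic :: ((real \<Rightarrow> 'a::metric_space) \<times> _) set)"
proof (intro equivI)
  show "asymptotic \<subseteq> geodesic_rays \<times> (geodesic_rays :: (real \<Rightarrow> 'a) set)"
    by (auto simp: asymptotic_def)
  show "refl_on geodesic_rays (asymptotic :: ((real \<Rightarrow> 'a) \<times> _) set)"
    by (auto simp: refl_on_def asymptotic_def)
  show "sym (asymptotic :: ((real \<Rightarrow> 'a) \<times> _) set)"
    by (auto simp: sym_def asymptotic_def dist_commute)
  show "trans (asymptotic :: ((real \<Rightarrow> 'a) \<times> _) set)"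
  proof (rule transI)
    fix c d e :: "real \<Rightarrow> 'a"
    assume "(c, d) \<in> asymptotic" "(d, e) \<in> asymptotic"
    then obtain C D where r: "c \<in> geodesic_rays" "e \<in> geodesic_rays"
      and C: "\<And>t. t \<ge> 0 \<Longrightarrow> dist (c t) (d t) \<le> C" and D: "\<And>t. t \<ge> 0 \<Longrightarrow> dist (d t) (e t) \<le> D"
      by (auto simp: asymptotic_def)
    have "dist (c t) (e t) \<le> C + D" if "t \<ge> 0" for t
      using C[OF that] D[OF that] dist_triangle[of "c t" "e t" "d t"] by linarith
    then show "(c, e) \<in> asymptotic"
      using r by (auto simp: asymptotic_def)
  qed
qed

lemma boundary_eq_class:
  assumes "\<xi> \<in> boundary" "c \<in> \<xi>"
  shows "\<xi> = asymptotic `` {c}"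
  using assms equiv_asymptotic unfolding boundary_def
  by (metis Image_singleton_iff equiv_class_eq_iff quotientE)

lemma boundary_mem_iff:
  "\<xi> \<in> boundary \<Longrightarrow> c \<in> \<xi> \<Longrightarrow> c' \<in> \<xi> \<longleftrightarrow> (c, c') \<in> asymptotic"
  by (metis boundary_eq_class Image_singleton_iff)

lemma boundary_eqI:
  "\<xi> \<in> boundary \<Longrightarrow> \<eta> \<in> boundary \<Longrightarrow> c \<in> \<xi> \<Longrightarrow> c \<in> \<eta> \<Longrightarrow> \<xi> = \<eta>"
  by (metis boundary_eq_class)

lemma boundary_rays: "\<xi> \<in> boundary \<Longrightarrow> c \<in> \<xi> \<Longrightarrow> c \<in> geodesic_rays"
  using boundary_mem_iff[of \<xi> c c] by (auto simp: asymptotic_def)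

lemma boundary_nonempty: "\<xi> \<in> boundary \<Longrightarrow> \<exists>c. c \<in> \<xi>"
  using equiv_asymptotic unfolding boundary_def by (metis ex_in_conv in_quotient_imp_non_empty)

lemma asymptoticI:
  assumes "c \<in> geodesic_rays" "c' \<in> geodesic_rays" "\<And>t. t \<ge> 0 \<Longrightarrow> dist (c t) (c' t) \<le> C"
  shows "(c, c') \<in> asymptotic"
  using assms by (auto simp: asymptotic_def)

lemma boundary_shift:
  assumes \<xi>: "\<xi> \<in> boundary" "c \<in> \<xi>" and a: "0 \<le> a"
  shows "(\<lambda>t. c (a + t)) \<in> \<xi>"
proof -
  have c: "c \<in> geodesic_rays"
    using boundary_rays[OF \<xi>] .
  have "(c, \<lambda>t. c (a + t)) \<in> asymptotic"
    using a by (intro asymptoticI[of _ _ a] c geodesic_rays_shift) (auto simp: geodesic_raysD[OF c])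
  then show ?thesis
    by (simp add: boundary_mem_iff[OF \<xi>])
qed

text \<open>The distance between the rays is convex in the parameter, bounded, and 0 at the
  start.\<close>

lemma asymptotic_unique:
  fixes c c' :: "real \<Rightarrow> 'a::metric_space"
  assumes cat: "CAT0_space TYPE('a)" and as: "(c, c') \<in> asymptotic" and c0: "c 0 = c' 0"
    and t: "0 \<le> t"
  shows "c t = c' t"
proof (rule ccontr)
  define d where "d = dist (c t) (c' t)"
  assume "c t \<noteq> c' t"
  then have d: "d > 0" and t: "t > 0"
    using c0 t by (auto simp: d_def less_le)
  obtain C where r: "c \<in> geodesic_rays" "c' \<in> geodesic_rays"
    and C: "\<And>t. t \<ge> 0 \<Longrightarrow> dist (c t) (c' t) \<le> C"
    using as by (auto simp: asymptotic_def)
  have C0: "C \<ge> 0"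
    using C[of 0] by (metis order_refl order_trans zero_le_dist)
  \<comment> \<open>Chosen so that \<open>s * C < d\<close>, while convexity between the times 0 and
    \<open>t / s\<close> gives \<open>d \<le> s * C\<close>.\<close>
  define s where "s = d / (C + d)"
  have s: "0 < s" "s \<le> 1" "s * C < d"
    using d C0 by (auto simp: s_def field_simps)
  have "d \<le> s * dist (c (t / s)) (c' (t / s))"
    using CAT0_rays_convex[OF cat r, of "t / s" "t / s" s] s t c0 by (simp add: d_def)
  also have "\<dots> \<le> s * C"
    using s t C by (intro mult_left_mono) auto
  finally show False
    using s by simp
qed

section \<open>Tychonoff compactness and cluster points of sequences of functions\<close>

lemma compact_fun_box:
  fixes K :: "'i \<Rightarrow> 'b::topological_space set"
  assumes "\<And>i. compact (K i)"
  shows "compact {f. \<forall>i. f i \<in> K i}"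
proof -
  have "compactin (product_topology (\<lambda>i. euclidean) UNIV) (Pi\<^sub>E UNIV K)"
    using assms by (simp add: compactin_PiE)
  moreover have "Pi\<^sub>E UNIV K = {f. \<forall>i. f i \<in> K i}"
    by auto
  ultimately show ?thesis
    by (simp add: euclidean_product_topology)
qed

text \<open>Over an uncountable index set a compact set of functions need not be sequentially
  compact, so cluster points take the role of limits of subsequences.\<close>

lemma compact_cluster_point:
  fixes f :: "nat \<Rightarrow> 'b::topological_space"
  assumes "compact K" "\<And>n. f n \<in> K"
  shows "\<exists>l\<in>K. \<forall>U. open U \<longrightarrow> l \<in> U \<longrightarrow> (\<exists>\<^sub>F n in sequentially. f n \<in> U)"
proof -
  have "eventually (\<lambda>x. x \<in> K) (filtermap f sequentially)"
    using assms by (simp add: eventually_filtermap)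
  moreover have "filtermap f sequentially \<noteq> bot"
    by (simp add: filtermap_bot_iff)
  ultimately obtain l where l: "l \<in> K" "inf (nhds l) (filtermap f sequentially) \<noteq> bot"
    using assms(1) unfolding compact_filter by blast
  have "\<exists>\<^sub>F n in sequentially. f n \<in> U" if "open U" "l \<in> U" for U
  proof (rule ccontr)
    assume "\<not> (\<exists>\<^sub>F n in sequentially. f n \<in> U)"
    then have "eventually (\<lambda>x. x \<notin> U) (filtermap f sequentially)"
      by (simp add: frequently_def eventually_filtermap)
    moreover have "eventually (\<lambda>x. x \<in> U) (nhds l)"
      using that by (simp add: eventually_nhds_in_open)
    ultimately have "eventually (\<lambda>x. False) (inf (nhds l) (filtermap f sequentially))"
      unfolding eventually_inf by blast
    then show False
      using l(2) by (simp add: trivial_limit_def)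
  qed
  then show ?thesis
    using l(1) by blast
qed

lemma cluster_point_closed:
  assumes cl: "\<And>U. open U \<Longrightarrow> l \<in> U \<Longrightarrow> \<exists>\<^sub>F n in sequentially. f n \<in> U"
    and A: "closed A" "eventually (\<lambda>n. f n \<in> A) sequentially"
  shows "l \<in> A"
proof (rule ccontr)
  assume "l \<notin> A"
  then have "\<exists>\<^sub>F n in sequentially. f n \<in> - A"
    using A(1) by (intro cl) auto
  then show False
    using A(2) by (simp add: frequently_def)
qed

text \<open>The segments from \<open>p\<close> to \<open>c n\<close> have a cluster point by
  Tychonoff's theorem. It is a ray, and convexity of the metric keeps it within \<open>2 * C\<close>
  of \<open>c\<close>.\<close>

lemma ex_ray_from_to:
  fixes p :: "'a::metric_space"
  assumes proper: "proper_space TYPE('a)" and cat: "CAT0_space TYPE('a)" and \<xi>: "\<xi> \<in> boundary"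
  shows "\<exists>c. c \<in> \<xi> \<and> c 0 = p"
proof -
  obtain c where c: "c \<in> \<xi>"
    using boundary_nonempty[OF \<xi>] by blast
  then have ray: "c \<in> geodesic_rays"
    using boundary_rays[OF \<xi>] by blast
  define C where "C = dist p (c 0)"
  define L where "L n = dist p (c (real n))" for n
  have "\<forall>n. \<exists>\<sigma>. geodesic_from_to \<sigma> p (c (real n))"
    using CAT0_geodesic[OF cat] by metis
  then obtain \<sigma> where \<sigma>: "\<And>n. geodesic_from_to (\<sigma> n) p (c (real n))"
    by metis
  \<comment> \<open>Clamping the parameter to the interval from 0 to \<open>L n\<close> turns all
    segments into total functions in one compact product of balls around \<open>p\<close>.\<close>
  define \<tau> where "\<tau> n t = \<sigma> n (max 0 (min t (L n)))" for n t
  have L0: "L n \<ge> 0" and L: "\<bar>L n - real n\<bar> \<le> C" for n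
  proof -
    show "L n \<ge> 0"
      by (simp add: L_def)
    show "\<bar>L n - real n\<bar> \<le> C"
      using dist_triangle[of p "c n" "c 0"] dist_triangle[of "c 0" "c n" p] geodesic_raysD[OF ray, of 0 n]
      by (simp add: L_def C_def dist_commute abs_le_iff)
  qed
  have d\<sigma>: "dist (\<sigma> n s) (\<sigma> n t) = \<bar>s - t\<bar>" if "0 \<le> s" "s \<le> L n" "0 \<le> t" "t \<le> L n" for n s t
    using geodesic_from_toD[OF \<sigma>] that by (simp add: L_def)
  have \<sigma>0: "\<sigma> n 0 = p" for n
    using geodesic_from_to_ends[OF \<sigma>] by simp
  have "dist p (\<tau> n t) \<le> \<bar>t\<bar>" for n t
    using d\<sigma>[of 0 n "max 0 (min t (L n))"] L0[of n] by (auto simp: \<tau>_def \<sigma>0)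
  then have box: "\<tau> n \<in> {f. \<forall>t. f t \<in> cball p \<bar>t\<bar>}" for n
    by auto
  have cpt: "compact {f. \<forall>t. f t \<in> cball p \<bar>t\<bar>}"
    using proper by (intro compact_fun_box) (simp add: proper_space_def)
  obtain l where l: "l \<in> {f. \<forall>t. f t \<in> cball p \<bar>t\<bar>}"
    and cl: "\<And>U. open U \<Longrightarrow> l \<in> U \<Longrightarrow> \<exists>\<^sub>F n in sequentially. \<tau> n \<in> U"
    using compact_cluster_point[OF cpt, of \<tau>, OF box] by blast
  have cont: "continuous_on UNIV (\<lambda>f :: real \<Rightarrow> 'a. f t)" for t
    using continuous_on_product_coordinates[of t] by simp
  have ev: "eventually (\<lambda>n. t \<le> real n \<and> t \<le> L n) sequentially" for t
  proof -
    obtain N where N: "t + C \<le> real N"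
      using real_arch_simple by blast
    have "t \<le> real n \<and> t \<le> L n" if "n \<ge> N" for n
    proof -
      have "real N \<le> real n"
        using that by simp
      moreover have "C \<ge> 0"
        by (simp add: C_def)
      ultimately show ?thesis
        using L[of n] N by linarith
    qed
    then show ?thesis
      by (auto simp: eventually_sequentially)
  qed
  have ray_l: "l \<in> geodesic_rays"
  proof (rule geodesic_raysI)
    fix s t :: real
    assume st: "0 \<le> s" "0 \<le> t"
    have "l \<in> {f. dist (f s) (f t) = \<bar>s - t\<bar>}"
    proof (rule cluster_point_closed[OF cl])
      show "closed {f :: real \<Rightarrow> 'a. dist (f s) (f t) = \<bar>s - t\<bar>}"
        by (intro closed_Collect_eq continuous_on_dist continuous_on_const cont)
      show "\<forall>\<^sub>F n in sequentially. \<tau> n \<in> {f. dist (f s) (f t) = \<bar>s - t\<bar>}"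
        using ev[of s] ev[of t] by eventually_elim (use st in \<open>auto simp: \<tau>_def d\<sigma>\<close>)
    qed auto
    then show "dist (l s) (l t) = \<bar>s - t\<bar>"
      by simp
  qed
  have close: "dist (c t) (l t) \<le> 2 * C" if t: "0 \<le> t" for t
  proof -
    have "l \<in> {f. dist (c t) (f t) \<le> 2 * C}"
    proof (rule cluster_point_closed[OF cl])
      show "closed {f. dist (c t) (f t) \<le> 2 * C}"
        by (intro closed_Collect_le continuous_on_dist continuous_on_const cont)
      show "\<forall>\<^sub>F n in sequentially. \<tau> n \<in> {f. dist (c t) (f t) \<le> 2 * C}"
        using ev[of t] eventually_gt_at_top[of 0]
      proof eventually_elim
        case (elim n)
        \<comment> \<open>\<open>c t\<close> is compared with the point at the same fraction
          \<open>s\<close> of the segment \<open>\<sigma> n\<close>. The parameter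
          \<open>s * L n\<close> of that point need not be \<open>t\<close>, but differs from it by
          at most \<open>C\<close>.\<close>
        define s where "s = t / real n"
        have s: "0 \<le> s" "s \<le> 1" "s * real n = t"
          using elim t by (auto simp: s_def)
        have sL: "0 \<le> s * L n" "s * L n \<le> L n"
          using s L0[of n] by (auto simp: mult_left_le_one_le)
        have gc: "geodesic_from_to c (c 0) (c (real n))" "dist (c 0) (c (real n)) = real n"
          using ray geodesic_from_to_subpath[of "{0..}" c 0 "real n"]
          by (auto simp: geodesic_rays_def)
        have "dist (c t) (\<sigma> n (s * L n)) \<le> (1 - s) * C"
          using CAT0_convex[OF cat gc(1) \<sigma>[of n] s(1,2)] s gc(2) by (simp add: L_def C_def dist_commute)
        also have "\<dots> \<le> C"
          using s by (simp add: C_def mult_left_le_one_le)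
        finally have 1: "dist (c t) (\<sigma> n (s * L n)) \<le> C" .
        have "s * L n - t = s * (L n - real n)"
          using s(3) by (simp add: algebra_simps)
        then have "\<bar>s * L n - t\<bar> = s * \<bar>L n - real n\<bar>"
          using s by (simp add: abs_mult)
        also have "\<dots> \<le> C"
          using s L[of n] by (meson abs_ge_zero mult_left_le_one_le order_trans)
        finally have 2: "dist (\<sigma> n (s * L n)) (\<sigma> n t) \<le> C"
          using d\<sigma>[OF sL t] elim by simp
        have "\<tau> n t = \<sigma> n t"
          using elim t by (simp add: \<tau>_def)
        then show ?case
          using 1 2 dist_triangle[of "c t" "\<sigma> n t" "\<sigma> n (s * L n)"] by simp
      qed
    qed auto
    then show ?thesis
      by simp
  qed
  have "l \<in> \<xi>"
    using boundary_mem_iff[OF \<xi> c] asymptoticI[OF ray ray_l close] by blast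
  \<comment> \<open>At parameter 0 the factor of the product is the ball of radius 0.\<close>
  moreover have "l 0 = p"
    using l by (auto dest: spec[of _ 0])
  ultimately show ?thesis
    by blast
qed

lemma ray_from_to:
  fixes p :: "'a::metric_space"
  assumes "proper_space TYPE('a)" "CAT0_space TYPE('a)" "\<xi> \<in> boundary"
  shows "ray_from_to p \<xi> \<in> \<xi>" "ray_from_to p \<xi> 0 = p"
  using someI_ex[OF ex_ray_from_to[OF assms, of p]] by (auto simp: ray_from_to_def)

lemma ray_from_to_eq:
  fixes c :: "real \<Rightarrow> 'a::metric_space"
  assumes "proper_space TYPE('a)" "CAT0_space TYPE('a)" "\<xi> \<in> boundary" "c \<in> \<xi>" "0 \<le> t"
  shows "ray_from_to (c 0) \<xi> t = c t"
proof (rule asymptotic_unique[OF assms(2) _ _ assms(5)])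
  show "(ray_from_to (c 0) \<xi>, c) \<in> asymptotic"
    using boundary_mem_iff[OF assms(3) ray_from_to(1)[OF assms(1-3)]] assms(4) by blast
  show "ray_from_to (c 0) \<xi> 0 = c 0"
    by (rule ray_from_to(2)[OF assms(1-3)])
qed

section \<open>The action on the boundary and angles\<close>

lemma isometryD:
  assumes "g \<in> carrier isometry_group"
  shows "bij g" "dist (g x) (g y) = dist x y"
  using assms by (auto simp: isometry_group_def)

lemma isometry_inv:
  assumes g: "g \<in> carrier isometry_group"
  shows "g (inv_into UNIV g x) = x" "inv_into UNIV g (g x) = x"
  using isometryD(1)[OF g] by (simp_all add: bij_is_inj bij_is_surj surj_f_inv_f)

lemma dist_isometry_inv:
  assumes g: "g \<in> carrier isometry_group"
  shows "dist (inv_into UNIV g x) y = dist x (g y)"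
  using isometryD(2)[OF g, of "inv_into UNIV g x" y] by (simp add: isometry_inv[OF g])

lemma inv_isometry_group:
  assumes g: "g \<in> carrier isometry_group"
  shows "m_inv isometry_group g = inv_into UNIV g" "inv_into UNIV g \<in> carrier isometry_group"
proof -
  show *: "inv_into UNIV g \<in> carrier isometry_group"
    using isometryD(1)[OF g]
    by (auto simp: isometry_group_def bij_imp_bij_inv dist_isometry_inv[OF g] isometry_inv[OF g])
  have "inv_into UNIV g \<otimes>\<^bsub>isometry_group\<^esub> g = \<one>\<^bsub>isometry_group\<^esub>"
    using isometryD(1)[OF g] by (simp add: isometry_group_def bij_is_inj)
  then show "m_inv isometry_group g = inv_into UNIV g"
    by (rule group.inv_equality[OF group_isometry_group _ g *])
qed

lemma isometry_subgroupD:
  assumes "subgroup G isometry_group"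
  shows "G \<subseteq> carrier isometry_group" "id \<in> G" "g \<in> G \<Longrightarrow> h \<in> G \<Longrightarrow> g \<circ> h \<in> G"
    "g \<in> G \<Longrightarrow> inv_into UNIV g \<in> G"
proof -
  show *: "G \<subseteq> carrier isometry_group"
    by (rule subgroup.subset[OF assms])
  show "id \<in> G" "g \<in> G \<Longrightarrow> h \<in> G \<Longrightarrow> g \<circ> h \<in> G"
    using subgroup.one_closed[OF assms] subgroup.m_closed[OF assms, of g h]
    by (auto simp: isometry_group_def)
  show "g \<in> G \<Longrightarrow> inv_into UNIV g \<in> G"
    using subgroup.m_inv_closed[OF assms, of g] inv_isometry_group(1)[of g] * by auto
qed

lemma boundary_action_comp: "boundary_action (g \<circ> h) \<xi> = boundary_action g (boundary_action h \<xi>)"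
  by (auto simp: boundary_action_def image_image o_assoc)

lemma boundary_action_id: "boundary_action id \<xi> = \<xi>"
  by (simp add: boundary_action_def)

lemma boundary_action_inv:
  assumes g: "g \<in> carrier isometry_group"
  shows "boundary_action (inv_into UNIV g) (boundary_action g \<xi>) = \<xi>"
    "boundary_action g (boundary_action (inv_into UNIV g) \<xi>) = \<xi>"
proof -
  have "inv_into UNIV g \<circ> g = id" "g \<circ> inv_into UNIV g = id"
    by (auto simp: fun_eq_iff isometry_inv[OF g])
  then show "boundary_action (inv_into UNIV g) (boundary_action g \<xi>) = \<xi>"
    "boundary_action g (boundary_action (inv_into UNIV g) \<xi>) = \<xi>"
    by (simp_all add: boundary_action_id flip: boundary_action_comp)
qed

lemma asymptotic_isometry:
  assumes g: "g \<in> carrier isometry_group"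
  shows "(g \<circ> c, g \<circ> c') \<in> asymptotic \<longleftrightarrow> (c, c') \<in> asymptotic"
  by (simp add: asymptotic_def geodesic_rays_def geodesic_on_def isometryD(2)[OF g])

lemma boundary_action_closed:
  assumes g: "g \<in> carrier isometry_group" and \<xi>: "\<xi> \<in> boundary"
  shows "boundary_action g \<xi> \<in> boundary"
proof -
  obtain c where c: "c \<in> \<xi>"
    using boundary_nonempty[OF \<xi>] by blast
  have "c \<in> geodesic_rays"
    by (rule boundary_rays[OF \<xi> c])
  then have gc: "g \<circ> c \<in> geodesic_rays"
    by (simp add: geodesic_rays_def geodesic_on_def isometryD(2)[OF g])
  have "boundary_action g \<xi> = asymptotic `` {g \<circ> c}"
  proof (intro equalityI subsetI)
    fix d assume "d \<in> boundary_action g \<xi>"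
    then obtain c' where "c' \<in> \<xi>" "d = g \<circ> c'"
      by (auto simp: boundary_action_def)
    then show "d \<in> asymptotic `` {g \<circ> c}"
      using asymptotic_isometry[OF g] boundary_mem_iff[OF \<xi> c] by simp
  next
    fix d assume d: "d \<in> asymptotic `` {g \<circ> c}"
    define c' where "c' = inv_into UNIV g \<circ> d"
    have e: "d = g \<circ> c'"
      by (auto simp: c'_def isometry_inv[OF g])
    then have "c' \<in> \<xi>"
      using d asymptotic_isometry[OF g, of c c'] boundary_mem_iff[OF \<xi> c] by simp
    then show "d \<in> boundary_action g \<xi>"
      using e by (auto simp: boundary_action_def)
  qed
  then show ?thesis
    using gc by (simp add: boundary_def quotientI)
qed

lemma ray_from_to_isometry:
  fixes p :: "'a::metric_space"
  assumes pc: "proper_space TYPE('a)" "CAT0_space TYPE('a)"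
    and g: "g \<in> carrier isometry_group" and \<xi>: "\<xi> \<in> boundary" and t: "0 \<le> t"
  shows "ray_from_to (g p) (boundary_action g \<xi>) t = g (ray_from_to p \<xi> t)"
proof -
  have "g \<circ> ray_from_to p \<xi> \<in> boundary_action g \<xi>"
    using ray_from_to(1)[OF pc \<xi>] by (auto simp: boundary_action_def)
  from ray_from_to_eq[OF pc boundary_action_closed[OF g \<xi>] this t] show ?thesis
    by (simp add: ray_from_to(2)[OF pc \<xi>])
qed

section \<open>Alexandrov angles and the Tits angle\<close>

text \<open>The upper limit at 0 sees only germs. Angles therefore carry over between rays that
  share an initial piece, whatever their values at negative parameters.\<close>

lemma alexandrov_angle_local:
  fixes c c' d d' :: "real \<Rightarrow> 'a::metric_space"
  assumes "r > 0" and "\<And>t. 0 \<le> t \<Longrightarrow> t \<le> r \<Longrightarrow> c t = d t" and "\<And>t. 0 \<le> t \<Longrightarrow> t \<le> r \<Longrightarrow> c' t = d' t"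
  shows "alexandrov_angle c c' = alexandrov_angle d d'"
proof -
  have ev: "\<forall>\<^sub>F t in at_right 0. 0 < t \<and> t < r"
    using assms(1) by (auto simp: eventually_at_right_field)
  have "\<forall>\<^sub>F x in at_right 0 \<times>\<^sub>F at_right 0.
      (case x of (s, t) \<Rightarrow> ereal (comparison_angle (c 0) (c s) (c' t))) =
      (case x of (s, t) \<Rightarrow> ereal (comparison_angle (d 0) (d s) (d' t)))"
    using eventually_prodI[OF ev ev]
  proof (rule eventually_mono)
    fix x :: "real \<times> real"
    assume "(0 < fst x \<and> fst x < r) \<and> (0 < snd x \<and> snd x < r)"
    then have "c 0 = d 0" "c (fst x) = d (fst x)" "c' (snd x) = d' (snd x)"
      using assms by simp_all
    then show "(case x of (s, t) \<Rightarrow> ereal (comparison_angle (c 0) (c s) (c' t))) =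
      (case x of (s, t) \<Rightarrow> ereal (comparison_angle (d 0) (d s) (d' t)))"
      by (simp add: case_prod_beta)
  qed
  then show ?thesis
    unfolding alexandrov_angle_def by (simp add: Limsup_eq)
qed

lemma angle_at_isometry:
  fixes p :: "'a::metric_space"
  assumes pc: "proper_space TYPE('a)" "CAT0_space TYPE('a)"
    and g: "g \<in> carrier isometry_group" and b: "\<xi> \<in> boundary" "\<eta> \<in> boundary"
  shows "angle_at (g p) (boundary_action g \<xi>) (boundary_action g \<eta>) = angle_at p \<xi> \<eta>"
proof -
  have "alexandrov_angle (ray_from_to (g p) (boundary_action g \<xi>)) (ray_from_to (g p) (boundary_action g \<eta>))
      = alexandrov_angle (g \<circ> ray_from_to p \<xi>) (g \<circ> ray_from_to p \<eta>)"
    by (rule alexandrov_angle_local[of 1]) (simp_all add: ray_from_to_isometry[OF pc g] b)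
  also have "\<dots> = alexandrov_angle (ray_from_to p \<xi>) (ray_from_to p \<eta>)"
    by (simp add: alexandrov_angle_def comparison_angle_def isometryD(2)[OF g])
  finally show ?thesis
    by (simp add: angle_at_def)
qed

text \<open>The bijection \<open>g\<close> permutes the points over which the supremum is
  taken.\<close>

lemma tits_angle_isometry:
  fixes \<xi> \<eta> :: "(real \<Rightarrow> 'a::metric_space) set"
  assumes pc: "proper_space TYPE('a)" "CAT0_space TYPE('a)"
    and g: "g \<in> carrier isometry_group" and b: "\<xi> \<in> boundary" "\<eta> \<in> boundary"
  shows "tits_angle (boundary_action g \<xi>) (boundary_action g \<eta>) = tits_angle \<xi> \<eta>"
proof -
  let ?f = "\<lambda>p. angle_at p (boundary_action g \<xi>) (boundary_action g \<eta>)"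
  have "range ?f = range (\<lambda>p. ?f (g p))"
    using image_image[of ?f g UNIV] by (simp add: bij_is_surj[OF isometryD(1)[OF g]])
  also have "\<dots> = range (\<lambda>p. angle_at p \<xi> \<eta>)"
    by (simp add: angle_at_isometry[OF pc g b])
  finally show ?thesis
    by (simp add: tits_angle_def)
qed

text \<open>The triangle inequalities put the argument of \<open>arccos\<close> in a comparison
  angle into its domain.\<close>

lemma comparison_angle_ratio:
  fixes p x y :: "'a::metric_space"
  assumes "x \<noteq> p" "y \<noteq> p"
  shows "\<bar>((dist p x)\<^sup>2 + (dist p y)\<^sup>2 - (dist x y)\<^sup>2) / (2 * dist p x * dist p y)\<bar> \<le> 1"
proof -
  define a b c where "a = dist p x" and "b = dist p y" and "c = dist x y"
  have pos: "a > 0" "b > 0" "c \<ge> 0"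
    using assms by (auto simp: a_def b_def c_def)
  have tri: "c \<le> a + b" "a \<le> b + c" "b \<le> a + c"
    unfolding a_def b_def c_def by metric+
  have "(a - b)\<^sup>2 \<le> c\<^sup>2" "c\<^sup>2 \<le> (a + b)\<^sup>2"
    using tri pos by (auto intro!: power_mono simp: abs_le_square_iff[symmetric])
  then have "\<bar>a\<^sup>2 + b\<^sup>2 - c\<^sup>2\<bar> \<le> 2 * a * b"
    by (auto simp: abs_le_iff power2_eq_square algebra_simps)
  then show ?thesis
    using pos by (simp add: abs_divide abs_mult divide_le_eq flip: a_def b_def c_def)
qed

lemma comparison_angle_bounds:
  assumes "x \<noteq> p" "y \<noteq> p"
  shows "0 \<le> comparison_angle p x y" "comparison_angle p x y \<le> pi"
  using comparison_angle_ratio[OF assms, unfolded abs_le_iff]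
  unfolding comparison_angle_def by (intro arccos_lbound arccos_ubound; linarith)+

text \<open>The bounds hold for the extended real upper limit, so \<open>real_of_ereal\<close> loses
  nothing. The last claim says that rays with angle 0 are tangent to first order.\<close>

lemma alexandrov_angle_rays:
  fixes c c' :: "real \<Rightarrow> 'a::metric_space"
  assumes c: "c \<in> geodesic_rays" and c': "c' \<in> geodesic_rays" and c0: "c 0 = c' 0"
  shows "0 \<le> alexandrov_angle c c'" "alexandrov_angle c c' \<le> pi"
    and "alexandrov_angle c c' = 0 \<Longrightarrow> 0 < e \<Longrightarrow> e < 1 \<Longrightarrow> \<forall>\<^sub>F s in at_right 0. dist (c s) (c' s) < e * s"
proof -
  let ?F = "at_right (0::real) \<times>\<^sub>F at_right (0::real)"
  let ?f = "\<lambda>(s, t). ereal (comparison_angle (c 0) (c s) (c' t))"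
  have ev: "\<forall>\<^sub>F t in at_right (0::real). 0 < t"
    by (simp add: eventually_at_right_less)
  have pos: "0 < s \<Longrightarrow> c s \<noteq> c 0" "0 < s \<Longrightarrow> c' s \<noteq> c 0" for s
    using geodesic_raysD[OF c, of s 0] geodesic_raysD[OF c', of s 0] c0 by auto
  have nt: "?F \<noteq> bot"
    by (simp add: prod_filter_eq_bot)
  have lo: "0 \<le> Limsup ?F ?f"
    by (intro le_Limsup[OF nt] eventually_mono[OF eventually_prodI[OF ev ev]])
      (auto simp: pos comparison_angle_bounds)
  have hi: "Limsup ?F ?f \<le> ereal pi"
    by (intro Limsup_bounded eventually_mono[OF eventually_prodI[OF ev ev]])
      (auto simp: pos comparison_angle_bounds)
  then obtain r where r: "Limsup ?F ?f = ereal r" "0 \<le> r" "r \<le> pi"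
    using lo by (cases "Limsup ?F ?f") auto
  then have eq: "alexandrov_angle c c' = r"
    by (simp add: alexandrov_angle_def)
  show "0 \<le> alexandrov_angle c c'" "alexandrov_angle c c' \<le> pi"
    using r eq by auto
  assume 0: "alexandrov_angle c c' = 0" and e: "0 < e" "e < 1"
  \<comment> \<open>\<open>arccos y\<close> is the apex angle of an isosceles Euclidean triangle
    with legs \<open>s\<close> and base \<open>e * s\<close>, for every
    \<open>s > 0\<close>.\<close>
  define y where "y = 1 - e\<^sup>2 / 2"
  have "e\<^sup>2 < 1"
    using e by (simp add: power_less_one_iff abs_square_less_1)
  then have y: "-1 < y" "y < 1"
    using e by (auto simp: y_def)
  have "Limsup ?F ?f < ereal (arccos y)"
    using 0 r(1) eq arccos_lt_bounded[OF y] by simp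
  then have "\<forall>\<^sub>F x in ?F. ?f x < ereal (arccos y)"
    by (rule Limsup_lessD)
  \<comment> \<open>The two parameters tend to 0 independently, so they may be set equal to one
    \<open>s\<close> below.\<close>
  then obtain P Q where P: "\<forall>\<^sub>F s in at_right 0. P s" and Q: "\<forall>\<^sub>F s in at_right 0. Q s"
    and PQ: "\<And>s t. P s \<Longrightarrow> Q t \<Longrightarrow> comparison_angle (c 0) (c s) (c' t) < arccos y"
    unfolding eventually_prod_filter by auto
  show "\<forall>\<^sub>F s in at_right 0. dist (c s) (c' s) < e * s"
    using P Q ev
  proof eventually_elim
    case (elim s)
    define d where "d = dist (c s) (c' s)"
    define x where "x = ((dist (c 0) (c s))\<^sup>2 + (dist (c 0) (c' s))\<^sup>2 - (dist (c s) (c' s))\<^sup>2)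
       / (2 * dist (c 0) (c s) * dist (c 0) (c' s))"
    have x1: "\<bar>x\<bar> \<le> 1"
      unfolding x_def by (rule comparison_angle_ratio) (use pos elim in auto)
    have "arccos x < arccos y"
      using PQ elim by (simp add: comparison_angle_def x_def)
    then have "y < x"
      using arccos_less_arccos x1 y by (metis abs_le_iff arccos_less_mono less_eq_real_def abs_less_iff minus_less_iff)
    moreover have "dist (c 0) (c s) = s" "dist (c 0) (c' s) = s"
      using geodesic_raysD[OF c, of 0 s] geodesic_raysD[OF c', of 0 s] c0 elim by auto
    then have "x = 1 - d\<^sup>2 / (2 * s\<^sup>2)"
      using elim by (simp add: x_def d_def field_simps power2_eq_square)
    ultimately have "d\<^sup>2 / (2 * s\<^sup>2) < e\<^sup>2 / 2"
      by (simp add: y_def)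
    then have "d\<^sup>2 < (e * s)\<^sup>2"
      using elim by (simp add: field_simps)
    then have "d < e * s"
      using e elim by (simp add: power2_less_imp_less)
    then show ?case
      by (simp add: d_def)
  qed
qed

text \<open>The uniform bound \<open>pi\<close> makes the real supremum defining the Tits angle a
  genuine upper bound.\<close>

lemma angle_at_bounds:
  fixes p :: "'a::metric_space"
  assumes pc: "proper_space TYPE('a)" "CAT0_space TYPE('a)" and b: "\<xi> \<in> boundary" "\<eta> \<in> boundary"
  shows "0 \<le> angle_at p \<xi> \<eta>" "angle_at p \<xi> \<eta> \<le> pi" "angle_at p \<xi> \<eta> \<le> tits_angle \<xi> \<eta>"
proof -
  have *: "0 \<le> angle_at p \<xi> \<eta>" "angle_at p \<xi> \<eta> \<le> pi" for p
    unfolding angle_at_def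
    by (rule alexandrov_angle_rays; simp add: ray_from_to(2)[OF pc] b boundary_rays[OF _ ray_from_to(1)[OF pc]])+
  then show "0 \<le> angle_at p \<xi> \<eta>" "angle_at p \<xi> \<eta> \<le> pi"
    by auto
  show "angle_at p \<xi> \<eta> \<le> tits_angle \<xi> \<eta>"
    unfolding tits_angle_def by (rule cSUP_upper) (use *(2) in \<open>auto simp: bdd_above_def\<close>)
qed

text \<open>If the angle at \<open>q = c(t)\<close> between \<open>\<xi>\<close> and \<open>\<eta>\<close> vanishes, then the segment from \<open>c(0)\<close> to \<open>q\<close>
  followed by the ray from \<open>q\<close> to \<open>\<eta>\<close> is again a geodesic ray, by convexity of the metric. So the
  ray from \<open>c(0)\<close> to \<open>\<eta>\<close> passes through every point of \<open>c\<close>.\<close>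

lemma angle_at_eq_0_imp_eq:
  fixes \<xi> \<eta> :: "(real \<Rightarrow> 'a::metric_space) set"
  assumes pc: "proper_space TYPE('a)" "CAT0_space TYPE('a)" and b: "\<xi> \<in> boundary" "\<eta> \<in> boundary"
    and angle: "\<And>p. angle_at p \<xi> \<eta> = 0"
  shows "\<xi> = \<eta>"
proof -
  obtain c where c: "c \<in> \<xi>"
    using boundary_nonempty[OF b(1)] by blast
  have rc: "c \<in> geodesic_rays"
    by (rule boundary_rays[OF b(1) c])
  define c' where "c' = ray_from_to (c 0) \<eta>"
  have c': "c' \<in> \<eta>" "c' 0 = c 0"
    unfolding c'_def by (rule ray_from_to[OF pc b(2)])+
  have "c' t = c t" if t: "0 \<le> t" for t
  proof -
    define e where "e = ray_from_to (c t) \<eta>"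
    have e: "e \<in> \<eta>" "e 0 = c t"
      unfolding e_def by (rule ray_from_to[OF pc b(2)])+
    have re: "e \<in> geodesic_rays"
      by (rule boundary_rays[OF b(2) e(1)])
    have "alexandrov_angle (\<lambda>s. c (t + s)) e = alexandrov_angle (ray_from_to (c t) \<xi>) e"
      using ray_from_to_eq[OF pc b(1) boundary_shift[OF b(1) c t]]
      by (intro alexandrov_angle_local[of 1]) auto
    then have a0: "alexandrov_angle (\<lambda>s. c (t + s)) e = 0"
      using angle[of "c t"] by (simp add: angle_at_def e_def)
    have small: "\<forall>\<^sub>F s in at_right 0. dist (c (t + s)) (e s) < r * s" if "0 < r" "r < 1" for r
      using alexandrov_angle_rays(3)[OF geodesic_rays_shift[OF rc t] re _ a0 that] e by simp
    have straight: "dist (c (t - u)) (e v) = u + v" if u: "0 \<le> u" "u \<le> t" and v: "0 \<le> v" for u v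
    proof (rule antisym)
      show "dist (c (t - u)) (e v) \<le> u + v"
        using dist_triangle[of "c (t - u)" "e v" "c t"] geodesic_raysD[OF rc, of "t - u" t]
          geodesic_raysD[OF re, of 0 v] e u v t by simp
      \<comment> \<open>Both geodesics issue from \<open>c t\<close>, so shrinking them by a small
        \<open>s\<close> scales the distance of their ends by at most \<open>s\<close>. Near
        \<open>c t\<close> the ray \<open>e\<close> may be replaced by \<open>c\<close> at a cost of
        at most \<open>s * r\<close>; then divide by \<open>s\<close>.\<close>
      have *: "u + v \<le> dist (c (t - u)) (e v) + r" if r: "0 < r" "r < 1" for r
      proof (cases "v = 0")
        case True
        then show ?thesis
          using geodesic_raysD[OF rc, of "t - u" t] e u t r by simp
      next
        case False
        define r' where "r' = r / (1 + v)"
        have r': "0 < r'" "r' < 1" "r' * v \<le> r"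
          using r v by (auto simp: r'_def field_simps)
        obtain \<delta> where \<delta>: "\<delta> > 0" "\<And>s. 0 < s \<Longrightarrow> s < \<delta> \<Longrightarrow> dist (c (t + s)) (e s) < r' * s"
          using small[OF r'(1,2)] by (auto simp: eventually_at_right_field)
        define s where "s = min 1 (\<delta> / (2 * v))"
        have "s * v \<le> \<delta> / (2 * v) * v"
          using v by (intro mult_right_mono) (auto simp: s_def)
        then have s: "0 < s" "s \<le> 1" "s * v < \<delta>"
          using \<delta>(1) v False by (auto simp: s_def)
        have gc: "geodesic_on {0..} c" and ge: "geodesic_on {0..} e"
          using rc re by (auto simp: geodesic_rays_def)
        have 1: "geodesic_from_to (\<lambda>x. c (t - u + x)) (c (t - u)) (c t)" "dist (c (t - u)) (c t) = u"
          using geodesic_from_to_subpath[OF gc, of "t - u" t] u by (auto simp: subset_iff)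
        have 2: "geodesic_from_to e (e 0) (e v)" "dist (e 0) (e v) = v"
          using geodesic_from_to_subpath[OF ge, of 0 v] v by (auto simp: subset_iff)
        have "dist (c (t - s * u)) (e (s * v)) \<le> s * dist (c (t - u)) (e v)"
          using CAT0_convex[OF pc(2) geodesic_from_to_reverse[OF 1(1)] 2(1), of s] s 1(2) 2(2) e(2)
          by (simp add: dist_commute)
        moreover have "dist (c (t - s * u)) (c (t + s * v)) = s * u + s * v"
        proof -
          have "s * u \<le> t"
            using s u by (meson mult_left_le_one_le order_trans less_imp_le)
          moreover have "0 \<le> s * u" "0 \<le> s * v"
            using s u v by auto
          ultimately show ?thesis
            using geodesic_raysD[OF rc, of "t - s * u" "t + s * v"] t by simp
        qed
        moreover have "dist (c (t + s * v)) (e (s * v)) < r' * (s * v)"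
          using s v False by (intro \<delta>) auto
        moreover have "r' * (s * v) \<le> s * r"
          using s r'(3) by (metis mult.assoc mult.commute mult_left_mono less_imp_le)
        ultimately have "s * (u + v) \<le> s * (dist (c (t - u)) (e v) + r)"
          using dist_triangle[of "c (t - s * u)" "c (t + s * v)" "e (s * v)"]
          by (simp add: dist_commute distrib_left)
        then show ?thesis
          using s by simp
      qed
      have "u + v \<le> dist (c (t - u)) (e v) + r" if "0 < r" for r
        using that *[of r] *[of "1 / 2"] by (cases "r < 1") auto
      then show "u + v \<le> dist (c (t - u)) (e v)"
        by (rule field_le_epsilon)
    qed
    define \<gamma> where "\<gamma> s = (if s \<le> t then c s else e (s - t))" for s
    have \<gamma>: "\<gamma> \<in> geodesic_rays"
    proof (rule geodesic_raysI)
      fix x y :: real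
      assume xy: "0 \<le> x" "0 \<le> y"
      have *: "dist (c x) (e (y - t)) = y - x" if "0 \<le> x" "x \<le> t" "t \<le> y" for x y
        using straight[of "t - x" "y - t"] that by simp
      show "dist (\<gamma> x) (\<gamma> y) = \<bar>x - y\<bar>"
        using xy *[of x y] *[of y x] geodesic_raysD[OF rc xy] geodesic_raysD[OF re, of "x - t" "y - t"]
        by (auto simp: \<gamma>_def dist_commute)
    qed
    have "dist (e s) (\<gamma> s) \<le> 2 * t" if s: "0 \<le> s" for s
    proof -
      \<comment> \<open>Up to a shift of the parameter by \<open>t\<close>, \<open>e\<close> is a
        final part of \<open>\<gamma>\<close>. At \<open>s = 0\<close> the first branch of
        \<open>\<gamma>\<close> applies, and the branches agree there.\<close>
      have "e (s + t - t) = \<gamma> (s + t)"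
        using s e(2) t by (cases "s = 0") (auto simp: \<gamma>_def)
      then show ?thesis
        using geodesic_raysD[OF \<gamma>, of "s + t" s] s t by simp
    qed
    then have "\<gamma> \<in> \<eta>"
      using boundary_mem_iff[OF b(2) e(1)] asymptoticI[OF re \<gamma>] by blast
    moreover have "\<gamma> 0 = c 0"
      using t by (simp add: \<gamma>_def)
    ultimately have "c' t = \<gamma> t"
      using ray_from_to_eq[OF pc b(2) _ t, of \<gamma>] by (simp add: c'_def)
    then show ?thesis
      by (simp add: \<gamma>_def)
  qed
  then have "(c', c) \<in> asymptotic"
    by (intro asymptoticI[of _ _ 0] boundary_rays[OF b(2) c'(1)] rc) simp
  then have "c \<in> \<eta>"
    using boundary_mem_iff[OF b(2) c'(1)] by blast
  then show ?thesis
    using boundary_eqI[OF b c] by blast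
qed

section \<open>Small groups of isometries\<close>

text \<open>\<open>m\<close> is the circumcentre of the orbit of \<open>y\<close>: it minimises
  \<open>f\<close>, the radius of the smallest closed ball around a point that contains the orbit.
  As the orbit is invariant, \<open>q m\<close> is a minimiser too, and if it differed from
  \<open>m\<close>, the midpoint of both would do better by the CN inequality.\<close>

lemma isometries_fixed_point:
  fixes y :: "'a::metric_space"
  assumes proper: "proper_space TYPE('a)" and cat: "CAT0_space TYPE('a)"
    and Q: "subgroup Q isometry_group"
    and r: "\<And>q. q \<in> Q \<Longrightarrow> dist (q y) y \<le> r"
  shows "\<exists>m. dist y m \<le> r \<and> (\<forall>q\<in>Q. q m = m)"
proof -
  note Q_id = isometry_subgroupD(2)[OF Q]
  have Q_dist: "dist (q v) (q w) = dist v w" if "q \<in> Q" for q v w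
    using isometryD(2) isometry_subgroupD(1)[OF Q] that by blast
  define f where "f z = (SUP q\<in>Q. dist (q y) z)" for z
  have bdd: "bdd_above ((\<lambda>q. dist (q y) z) ` Q)" for z
  proof (rule bdd_aboveI2)
    fix q assume "q \<in> Q"
    then show "dist (q y) z \<le> r + dist y z"
      using r[of q] dist_triangle[of "q y" z y] by linarith
  qed
  have f_upper: "dist (q y) z \<le> f z" if "q \<in> Q" for q z
    unfolding f_def by (rule cSUP_upper[OF that bdd])
  have f_least: "f z \<le> b" if "\<And>q. q \<in> Q \<Longrightarrow> dist (q y) z \<le> b" for z b
    unfolding f_def using Q_id that by (intro cSUP_least) auto
  have f_lip: "f z \<le> f w + dist z w" for z w
  proof (rule f_least)
    fix q assume "q \<in> Q"
    then show "dist (q y) z \<le> f w + dist z w"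
      using f_upper[of q w] dist_triangle[of "q y" z w] by (simp add: dist_commute)
  qed
  have f_cont: "continuous_on S f" for S
    unfolding continuous_on_iff
  proof (intro ballI allI impI)
    fix x and e :: real assume "e > 0"
    moreover have "dist (f z) (f w) \<le> dist z w" for z w
      using f_lip[of z w] f_lip[of w z] by (simp add: dist_real_def dist_commute abs_le_iff)
    ultimately show "\<exists>d>0. \<forall>x'\<in>S. dist x' x < d \<longrightarrow> dist (f x') (f x) < e"
      by (meson le_less_trans)
  qed
  have r0: "0 \<le> r"
    using r[OF Q_id] by simp
  then obtain m where m: "m \<in> cball y r" "\<And>z. z \<in> cball y r \<Longrightarrow> f m \<le> f z"
    using continuous_attains_inf[of "cball y r" f] proper f_cont by (auto simp: proper_space_def)
  have fy: "f y \<le> r"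
    by (intro f_least r)
  \<comment> \<open>Outside \<open>cball y r\<close> already
    \<open>f z \<ge> dist y z > r \<ge> f y\<close>, so the minimum over the compact ball is
    global.\<close>
  have min: "f m \<le> f z" for z
  proof (cases "z \<in> cball y r")
    case False
    then show ?thesis
      using m(2)[of y] r0 fy f_upper[OF Q_id, of z] by simp
  qed (rule m)
  have "q m = m" if q: "q \<in> Q" for q
  proof -
    have fq: "f (q m) \<le> f m"
    proof (rule f_least)
      fix q' assume q': "q' \<in> Q"
      have "dist (q' y) (q m) = dist ((inv_into UNIV q \<circ> q') y) m"
        using dist_isometry_inv[of q "q' y" m] isometry_subgroupD(1)[OF Q] q by auto
      also have "\<dots> \<le> f m"
        by (intro f_upper isometry_subgroupD(3,4)[OF Q] q q')
      finally show "dist (q' y) (q m) \<le> f m" .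
    qed
    have fm0: "0 \<le> f m"
      using f_upper[OF Q_id, of m] order_trans[OF zero_le_dist] by blast
    obtain z where z: "\<And>x. (dist x z)\<^sup>2 \<le> ((dist x m)\<^sup>2 + (dist x (q m))\<^sup>2) / 2 - (dist m (q m))\<^sup>2 / 4"
      using CAT0_midpoint[OF cat] by blast
    have *: "(dist (q' y) z)\<^sup>2 \<le> (f m)\<^sup>2 - (dist m (q m))\<^sup>2 / 4" if q': "q' \<in> Q" for q'
    proof -
      have "(dist (q' y) m)\<^sup>2 \<le> (f m)\<^sup>2" "(dist (q' y) (q m))\<^sup>2 \<le> (f m)\<^sup>2"
        using f_upper[OF q', of m] f_upper[OF q', of "q m"] fq by (auto intro!: power_mono)
      moreover have "c \<le> F - d" if "a \<le> F" "b \<le> F" "c \<le> (a + b) / 2 - d" for a b c d F :: real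
        using that by (simp add: field_simps)
      ultimately show ?thesis
        using z[of "q' y"] by blast
    qed
    have "f z \<le> sqrt ((f m)\<^sup>2 - (dist m (q m))\<^sup>2 / 4)"
      by (intro f_least real_le_rsqrt *)
    then have "f m \<le> sqrt ((f m)\<^sup>2 - (dist m (q m))\<^sup>2 / 4)"
      using min[of z] by linarith
    moreover have "0 \<le> (f m)\<^sup>2 - (dist m (q m))\<^sup>2 / 4"
      using *[OF Q_id] zero_le_power2 order_trans by blast
    ultimately have "(f m)\<^sup>2 \<le> (f m)\<^sup>2 - (dist m (q m))\<^sup>2 / 4"
      using fm0 by (metis power_mono real_sqrt_pow2)
    then show ?thesis
      by simp
  qed
  then show ?thesis
    using m(1) by auto
qed

text \<open>If \<open>p\<close> were the fixed point nearest to a non-fixed point \<open>y\<close>, then the geodesic from \<open>p\<close>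
  through \<open>y\<close>, prolonged to length 1, would end within \<open>1/2\<close> of another fixed point \<open>m\<close>; the
  geodesic from \<open>p\<close> to \<open>m\<close> consists of fixed points and passes closer to \<open>y\<close> than \<open>p\<close>.\<close>

lemma small_isometries_fix_ball:
  fixes x :: "'a::metric_space"
  assumes proper: "proper_space TYPE('a)" and cat: "CAT0_space TYPE('a)"
    and complete: "geodesically_complete TYPE('a)"
    and Q: "subgroup Q isometry_group"
    and small: "\<And>q y. q \<in> Q \<Longrightarrow> y \<in> cball x (R + 1) \<Longrightarrow> dist (q y) y \<le> 1 / 2"
    and q: "q \<in> Q" and y: "y \<in> cball x R"
  shows "q y = y"
proof (rule ccontr)
  assume "q y \<noteq> y"
  define F where "F = {m. \<forall>q\<in>Q. q m = m}"
  have yF: "y \<notin> F"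
    using q \<open>q y \<noteq> y\<close> by (auto simp: F_def)
  have iso: "dist (q v) (q w) = dist v w" if "q \<in> Q" for q v w
    using isometryD(2) isometry_subgroupD(1)[OF Q] that by blast
  have near: "\<exists>m\<in>F. dist z m \<le> 1 / 2" if "z \<in> cball x (R + 1)" for z
    using isometries_fixed_point[OF proper cat Q, of z "1 / 2"] small[OF _ that] by (auto simp: F_def)
  have "continuous_on UNIV q" if "q \<in> Q" for q
    using iso[OF that] by (metis continuous_on_iff)
  then have "closed (\<Inter>q\<in>Q. {m. q m = m})"
    by (intro closed_INT ballI closed_Collect_eq continuous_on_id)
  moreover have "(\<Inter>q\<in>Q. {m. q m = m}) = F"
    by (auto simp: F_def)
  ultimately have "closed F"
    by simp
  then have "compact (cball y (1 / 2) \<inter> F)"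
    using proper by (intro compact_Int_closed) (auto simp: proper_space_def)
  moreover have "cball y (1 / 2) \<inter> F \<noteq> {}"
    using near[of y] y by force
  moreover have "continuous_on (cball y (1 / 2) \<inter> F) (dist y)"
    by (intro continuous_intros)
  ultimately obtain p where p: "p \<in> cball y (1 / 2) \<inter> F"
    and pmin': "\<And>z. z \<in> cball y (1 / 2) \<inter> F \<Longrightarrow> dist y p \<le> dist y z"
    using continuous_attains_inf[of "cball y (1 / 2) \<inter> F" "dist y"] by blast
  have pmin: "dist y p \<le> dist y z" if "z \<in> F" for z
    using that p pmin'[of z] by (cases "z \<in> cball y (1 / 2)") auto
  define \<delta> where "\<delta> = dist p y"
  have \<delta>: "0 < \<delta>" "\<delta> \<le> 1 / 2"
    using p yF by (auto simp: \<delta>_def dist_commute)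
  obtain c where c: "geodesic_from_to c p y"
    using CAT0_geodesic[OF cat] .
  obtain l where l: "geodesic_on UNIV l" and lc: "\<And>t. 0 \<le> t \<Longrightarrow> t \<le> \<delta> \<Longrightarrow> l t = c t"
    using complete c \<delta> unfolding geodesically_complete_def \<delta>_def by (metis atLeastAtMost_iff dist_self less_irrefl)
  have l0: "l 0 = p" "l \<delta> = y"
    using lc[of 0] lc[of \<delta>] \<delta> geodesic_from_to_ends[OF c] by (auto simp: \<delta>_def)
  \<comment> \<open>Here the extra 1 in the radius \<open>R + 1\<close> is used: the end of the
    prolonged geodesic stays where displacements are small.\<close>
  have "dist y (l 1) = 1 - \<delta>"
    using l \<delta> l0 by (auto simp: geodesic_on_def simp flip: l0(2))
  then have "l 1 \<in> cball x (R + 1)"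
    using y \<delta> dist_triangle[of x "l 1" y] by simp
  then obtain m where m: "m \<in> F" "dist (l 1) m \<le> 1 / 2"
    using near by blast
  obtain e where e: "geodesic_from_to e p m"
    using CAT0_geodesic[OF cat] .
  \<comment> \<open>An isometry fixing both ends of a geodesic fixes it pointwise, by
    uniqueness.\<close>
  have "q (e t) = e t" if "0 \<le> t" "t \<le> dist p m" "q \<in> Q" for q t
  proof -
    have "geodesic_from_to (q \<circ> e) p m"
      using e p m(1) that(3) by (auto simp: geodesic_from_to_def geodesic_on_def iso F_def)
    from CAT0_unique_geodesic[OF cat this e that(1,2)] show ?thesis
      by simp
  qed
  then have "e (\<delta> * dist p m) \<in> F"
    using \<delta> by (auto simp: F_def mult_left_le_one_le)
  moreover have "dist (l \<delta>) (e (\<delta> * dist p m)) \<le> \<delta> * dist (l 1) m"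
  proof -
    have "geodesic_from_to l p (l 1)" "dist p (l 1) = 1"
      using geodesic_from_to_subpath[OF l, of 0 1] l0 by auto
    then show ?thesis
      using CAT0_fork[OF cat _ e, of l "l 1" \<delta>] \<delta> by simp
  qed
  moreover have "\<delta> * dist (l 1) m \<le> \<delta> * (1 / 2)"
    using m(2) \<delta> by (intro mult_left_mono) auto
  ultimately show False
    using pmin[of "e (\<delta> * dist p m)"] \<delta>(1) dist_commute[of y p]
    unfolding l0(2) \<delta>_def[symmetric] by linarith
qed

section \<open>The topology of pointwise convergence on isometries\<close>

lemma continuous_on_apply: "continuous_on S (\<lambda>f. f x :: 'b::topological_space)"
  using continuous_on_subset[OF continuous_on_product_coordinates[of x]] by simp

lemma open_fun_nbhd:
  fixes g :: "'i \<Rightarrow> 'b::metric_space"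
  assumes "finite F"
  shows "open {h. \<forall>x\<in>F. dist (g x) (h x) < e}"
proof -
  have "open (\<Inter>x\<in>F. {h. dist (g x) (h x) < e})"
    using assms
    by (intro open_INT ballI open_Collect_less continuous_on_dist continuous_on_const continuous_on_apply)
  moreover have "(\<Inter>x\<in>F. {h. dist (g x) (h x) < e}) = {h. \<forall>x\<in>F. dist (g x) (h x) < e}"
    by auto
  ultimately show ?thesis
    by simp
qed

lemma open_fun_contains_nbhd:
  fixes g :: "'i \<Rightarrow> 'b::metric_space"
  assumes "open U" "g \<in> U"
  shows "\<exists>F e. finite F \<and> e > 0 \<and> {h. \<forall>x\<in>F. dist (g x) (h x) < e} \<subseteq> U"
proof -
  have "openin (product_topology (\<lambda>i. euclidean) UNIV) U"
    using assms(1) by (simp add: open_fun_def)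
  from product_topology_open_contains_basis[OF this assms(2)] obtain X
    where X: "g \<in> (\<Pi>\<^sub>E i\<in>UNIV. X i)" "\<And>i. open (X i)" "finite {i. X i \<noteq> UNIV}"
      "(\<Pi>\<^sub>E i\<in>UNIV. X i) \<subseteq> U"
    by auto
  have "\<forall>i. \<exists>e>0. ball (g i) e \<subseteq> X i"
    using X(1,2) by (auto simp: open_contains_ball PiE_iff)
  then obtain e where e: "\<And>i. e i > 0" "\<And>i. ball (g i) (e i) \<subseteq> X i"
    by metis
  define F where "F = {i. X i \<noteq> UNIV}"
  \<comment> \<open>The inserted 1 covers the case that no coordinate is restricted.\<close>
  define d where "d = Min (insert 1 (e ` F))"
  have fin: "finite F"
    using X(3) by (simp add: F_def)
  have d: "d > 0" "\<And>i. i \<in> F \<Longrightarrow> d \<le> e i"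
    using fin e(1) by (auto simp: d_def)
  have "h \<in> U" if h: "\<And>x. x \<in> F \<Longrightarrow> dist (g x) (h x) < d" for h
  proof -
    have "h i \<in> X i" for i
    proof (cases "i \<in> F")
      case True
      then show ?thesis
        using h[OF True] d(2)[OF True] e(2)[of i] by force
    qed (simp add: F_def)
    then show ?thesis
      using X(4) by (auto simp: PiE_iff)
  qed
  then have "{h. \<forall>x\<in>F. dist (g x) (h x) < d} \<subseteq> U"
    by (metis (mono_tags, lifting) mem_Collect_eq subsetI)
  with fin d(1) show ?thesis
    by (intro exI[of _ F] exI[of _ d] conjI)
qed

text \<open>\<open>F\<close> is a finite net of mesh \<open>e / 4\<close> in \<open>K\<close>. It
  serves all pairs of isometries at once, the errors adding up to
  \<open>e / 4 + e / 2 + e / 4\<close>, so pointwise closeness gives uniform closeness on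
  compacta.\<close>

lemma isometries_uniformly_close:
  fixes K :: "'a::metric_space set"
  assumes "compact K" "0 < e"
  shows "\<exists>F. finite F \<and> (\<forall>g h :: 'a \<Rightarrow> 'a. (\<forall>x y. dist (g x) (g y) = dist x y) \<longrightarrow>
    (\<forall>x y. dist (h x) (h y) = dist x y) \<longrightarrow> (\<forall>x\<in>F. dist (g x) (h x) < e / 2) \<longrightarrow>
    (\<forall>x\<in>K. dist (g x) (h x) < e))"
proof -
  have "K \<subseteq> (\<Union>x\<in>K. ball x (e / 4))"
    using assms(2) by auto
  then obtain F where F: "F \<subseteq> K" "finite F" "K \<subseteq> (\<Union>x\<in>F. ball x (e / 4))"
    using compactE_image[OF assms(1), of K "\<lambda>x. ball x (e / 4)"] by blast
  show ?thesis
  proof (intro exI[of _ F] conjI allI impI ballI F(2))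
    fix g h :: "'a \<Rightarrow> 'a" and x
    assume g: "\<forall>x y. dist (g x) (g y) = dist x y" and h: "\<forall>x y. dist (h x) (h y) = dist x y"
      and close: "\<forall>x\<in>F. dist (g x) (h x) < e / 2" and x: "x \<in> K"
    obtain z where z: "z \<in> F" "dist z x < e / 4"
      using F(3) x by auto
    have "dist (g x) (g z) = dist z x" "dist (h z) (h x) = dist z x" "dist (g z) (h z) < e / 2"
      using g h close z(1) by (simp_all add: dist_commute)
    then show "dist (g x) (h x) < e"
      using z(2) dist_triangle[of "g x" "h x" "g z"] dist_triangle[of "g z" "h x" "h z"] by linarith
  qed
qed

text \<open>The right-hand side carries the library's topology on functions, that of pointwise convergence.\<close>

lemma isometry_topology_eq:
  "(isometry_topology :: ('a::metric_space \<Rightarrow> 'a) topology) = top_of_set (carrier isometry_group)"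
proof (rule topology_eq[THEN iffD2], intro allI iffI)
  fix U :: "('a \<Rightarrow> 'a) set"
  assume U: "openin isometry_topology U"
  show "openin (top_of_set (carrier isometry_group)) U"
  proof (subst openin_subopen, intro ballI)
    fix g assume g: "g \<in> U"
    then obtain K e where K: "compact K" "e > 0"
      and KU: "\<And>h. h \<in> carrier isometry_group \<Longrightarrow> \<forall>x\<in>K. dist (g x) (h x) < e \<Longrightarrow> h \<in> U"
      and gi: "g \<in> carrier isometry_group"
      using U unfolding openin_isometry_topology by blast
    obtain F where F: "finite F" and FK: "\<And>g h :: 'a \<Rightarrow> 'a. (\<forall>x y. dist (g x) (g y) = dist x y) \<Longrightarrow>
      (\<forall>x y. dist (h x) (h y) = dist x y) \<Longrightarrow> (\<forall>x\<in>F. dist (g x) (h x) < e / 2) \<Longrightarrow>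
      (\<forall>x\<in>K. dist (g x) (h x) < e)"
      using isometries_uniformly_close[OF K] by blast
    define T where "T = carrier isometry_group \<inter> {h. \<forall>x\<in>F. dist (g x) (h x) < e / 2}"
    have "openin (top_of_set (carrier isometry_group)) T"
      unfolding T_def by (rule openin_open_Int[OF open_fun_nbhd[OF F]])
    moreover have "g \<in> T"
      using gi K(2) by (simp add: T_def)
    moreover have "T \<subseteq> U"
    proof
      fix h assume "h \<in> T"
      then show "h \<in> U"
        using KU[of h] FK[of g h] isometryD(2)[OF gi] isometryD(2)[of h] by (simp add: T_def)
    qed
    ultimately show "\<exists>T. openin (top_of_set (carrier isometry_group)) T \<and> g \<in> T \<and> T \<subseteq> U"
      by blast
  qed
next
  fix U :: "('a \<Rightarrow> 'a) set"
  assume "openin (top_of_set (carrier isometry_group)) U"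
  then obtain T where T: "open T" "U = carrier isometry_group \<inter> T"
    by (auto simp: openin_open)
  show "openin isometry_topology U"
    unfolding openin_isometry_topology
  proof (intro conjI ballI)
    fix g assume "g \<in> U"
    then obtain F e where "finite F" "e > 0" "{h. \<forall>x\<in>F. dist (g x) (h x) < e} \<subseteq> T"
      using open_fun_contains_nbhd[OF T(1), of g] T(2) by blast
    then show "\<exists>K e. compact K \<and> e > 0 \<and>
        (\<forall>h\<in>carrier isometry_group. (\<forall>x\<in>K. dist (g x) (h x) < e) \<longrightarrow> h \<in> U)"
      using T(2) finite_imp_compact by (intro exI[of _ F] exI[of _ e]) auto
  qed (use T(2) in auto)
qed

text \<open>These isometries lie in a compact product of balls, so only closedness is at stake.
  Preserving distances is a closed condition; surjectivity of a pointwise limit needs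
  properness.\<close>

lemma compact_isometries:
  fixes x :: "'a::metric_space"
  assumes proper: "proper_space TYPE('a)" and G: "closedin isometry_topology G"
  shows "compact {g \<in> G. dist x (g x) \<le> D}"
proof -
  define I where "I = {g :: 'a \<Rightarrow> 'a. \<forall>y z. dist (g y) (g z) = dist y z}"
  define B where "B = {g \<in> carrier isometry_group. dist x (g x) \<le> D}"
  have closedI: "closed (I \<inter> {g. dist x (g x) \<le> D})"
    unfolding I_def
    by (intro closed_Int closed_Collect_all closed_Collect_eq closed_Collect_le continuous_on_dist
        continuous_on_const continuous_on_apply)
  have BI: "B \<subseteq> I \<inter> {g. dist x (g x) \<le> D}"
    by (auto simp: B_def I_def isometry_group_def)
  have "closure B \<subseteq> B"
  proof
    fix g assume g: "g \<in> closure B"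
    then have gI: "g \<in> I \<inter> {g. dist x (g x) \<le> D}"
      using closure_minimal[OF BI closedI] by blast
    have iso: "dist (g y) (g z) = dist y z" for y z
      using gI by (simp add: I_def)
    \<comment> \<open>If \<open>h\<close> in \<open>B\<close> is close to \<open>g\<close> on
      \<open>K\<close>, then the preimage of \<open>y\<close> under \<open>h\<close> lies in
      \<open>K\<close>, so \<open>g\<close> maps it close to \<open>y\<close>. The image of
      \<open>K\<close> under \<open>g\<close> is compact, hence closed.\<close>
    have "y \<in> range g" for y
    proof -
      define K where "K = cball x (D + dist x y)"
      have K: "compact K"
        using proper by (simp add: K_def proper_space_def)
      have "compact (g ` K)"
        using K by (intro compact_continuous_image) (auto simp: continuous_on_iff iso)
      then have "closed (g ` K)"
        by (rule compact_imp_closed)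
      moreover have "y \<in> closure (g ` K)"
        unfolding closure_approachable
      proof (intro allI impI)
        fix e :: real assume e: "0 < e"
        obtain F where F: "finite F" and FK: "\<And>g h :: 'a \<Rightarrow> 'a. (\<forall>x y. dist (g x) (g y) = dist x y) \<Longrightarrow>
          (\<forall>x y. dist (h x) (h y) = dist x y) \<Longrightarrow> (\<forall>x\<in>F. dist (g x) (h x) < e / 2) \<Longrightarrow>
          (\<forall>x\<in>K. dist (g x) (h x) < e)"
          using isometries_uniformly_close[OF K e] by blast
        have "g \<in> {h. \<forall>x\<in>F. dist (g x) (h x) < e / 2}"
          using e by simp
        then have "{h. \<forall>x\<in>F. dist (g x) (h x) < e / 2} \<inter> B \<noteq> {}"
          using open_Int_closure_eq_empty[OF open_fun_nbhd[OF F, of g "e / 2"], of B] g by blast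
        then obtain h where h: "h \<in> B" "\<forall>x\<in>F. dist (g x) (h x) < e / 2"
          by blast
        have hi: "h \<in> carrier isometry_group" and hD: "dist x (h x) \<le> D"
          using h(1) by (auto simp: B_def)
        have close: "\<forall>x\<in>K. dist (g x) (h x) < e"
          using FK[of g h] iso h(2) isometryD(2)[OF hi] by blast
        define z where "z = inv_into UNIV h y"
        have hz: "h z = y"
          by (simp add: z_def isometry_inv[OF hi])
        have "dist x z = dist (h x) y"
          using isometryD(2)[OF hi, of x z] hz by simp
        also have "\<dots> \<le> D + dist x y"
          using dist_triangle[of "h x" y x] hD by (simp add: dist_commute)
        finally have "z \<in> K"
          by (simp add: K_def)
        then show "\<exists>w\<in>g ` K. dist w y < e"
          using close hz by auto
      qed
      ultimately show ?thesis
        by (auto simp: closure_closed)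
    qed
    moreover have "inj g"
      using iso by (metis dist_eq_0_iff injI)
    ultimately have "bij g"
      by (auto simp: bij_def)
    then show "g \<in> B"
      using gI by (auto simp: B_def I_def isometry_group_def)
  qed
  then have "closed B"
    using closure_subset_eq by blast
  moreover have "B \<subseteq> {g. \<forall>y. g y \<in> cball x (D + dist x y)}"
  proof
    fix g assume "g \<in> B"
    then have g: "g \<in> carrier isometry_group" "dist x (g x) \<le> D"
      by (auto simp: B_def)
    have "dist x (g y) \<le> D + dist x y" for y
      using dist_triangle[of x "g y" "g x"] isometryD(2)[OF g(1), of x y] g(2) by simp
    then show "g \<in> {g. \<forall>y. g y \<in> cball x (D + dist x y)}"
      by simp
  qed
  moreover have "compact {g. \<forall>y. g y \<in> cball x (D + dist x y)}"
    using proper by (intro compact_fun_box) (simp add: proper_space_def)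
  ultimately have "compact B"
    by (metis compact_Int_closed inf.absorb_iff2)
  moreover obtain T where "closed T" "G = carrier isometry_group \<inter> T"
    using G unfolding isometry_topology_eq by (auto simp: closedin_closed)
  moreover from this have "{g \<in> G. dist x (g x) \<le> D} = B \<inter> T"
    by (auto simp: B_def)
  ultimately show ?thesis
    by (simp add: compact_Int_closed)
qed

section \<open>Stabilizers of balls and limits of orbit points\<close>

text \<open>Van Dantzig: compact open neighbourhoods \<open>U\<close> of the identity exist by total disconnectedness, and
  the elements whose right translations preserve such a \<open>U\<close> form an open subgroup inside \<open>U\<close>.\<close>

lemma pointwise_stabilizer_ball_open:
  fixes x :: "'a::metric_space" and G :: "('a \<Rightarrow> 'a) set"
  assumes proper: "proper_space TYPE('a)" and cat: "CAT0_space TYPE('a)"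
    and complete: "geodesically_complete TYPE('a)"
    and G: "subgroup G isometry_group" and G_closed: "closedin isometry_topology G"
    and td: "totally_disconnected (subtopology isometry_topology G)"
  shows "\<exists>F e. finite F \<and> e > 0 \<and>
    (\<forall>g\<in>G. (\<forall>y\<in>F. dist y (g y) < e) \<longrightarrow> (\<forall>y\<in>cball x R. g y = y))"
proof -
  note GD = isometry_subgroupD[OF G]
  have iso: "dist (g y) (g z) = dist y z" if "g \<in> G" for g y z
    using isometryD(2) GD(1) that by blast
  \<comment> \<open>A compact neighbourhood of the identity in \<open>G\<close>, which itself need
    not be compact.\<close>
  define C where "C = {g \<in> G. dist x (g x) \<le> 1}"
  have C: "compact C"
    unfolding C_def by (rule compact_isometries[OF proper G_closed])
  have "compact (cball x (R + 1))"
    using proper by (simp add: proper_space_def)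
  from isometries_uniformly_close[OF this, of "1 / 2"] obtain F0
    where F0: "finite F0" and F0_close: "\<And>g h :: 'a \<Rightarrow> 'a. (\<forall>x y. dist (g x) (g y) = dist x y) \<Longrightarrow>
      (\<forall>x y. dist (h x) (h y) = dist x y) \<Longrightarrow> (\<forall>x\<in>F0. dist (g x) (h x) < 1 / 4) \<Longrightarrow>
      (\<forall>y\<in>cball x (R + 1). dist (g y) (h y) < 1 / 2)"
    by auto
  \<comment> \<open>The points of \<open>F0\<close> force displacements below \<open>1 / 2\<close>
    on \<open>cball x (R + 1)\<close>; \<open>x\<close> is inserted so that elements of
    \<open>G\<close> in \<open>O1\<close> lie in \<open>C\<close>.\<close>
  define O1 where "O1 = {g. \<forall>y\<in>insert x F0. dist (id y) (g y) < 1 / 4}"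
  have O1: "open O1"
    unfolding O1_def using F0 by (intro open_fun_nbhd) simp
  have id_O1: "id \<in> O1"
    by (simp add: O1_def)
  have id_C: "id \<in> C"
    using GD(2) by (simp add: C_def)
  have sub: "subtopology isometry_topology G = top_of_set G"
    using GD(1) by (simp add: isometry_topology_eq subtopology_subtopology inf.absorb2)
  have "Hausdorff_space (product_topology (\<lambda>_::'a. euclidean :: 'a topology) UNIV)"
    by (simp add: Hausdorff_space_product_topology)
  then have Hausdorff: "Hausdorff_space (top_of_set C)"
    by (simp add: Hausdorff_space_subtopology euclidean_product_topology)
  \<comment> \<open>No connected set joins the identity to \<open>C - O1\<close>. In the compact
    Hausdorff space \<open>C\<close> a clopen set \<open>U\<close> then separates them.\<close>
  have "separated_between (top_of_set C) {id} (C - O1)"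
  proof (rule cut_wire_fence_theorem)
    show "compact_space (top_of_set C)"
      using C by (simp add: compact_space_subtopology)
    show "Hausdorff_space (top_of_set C)"
      by (rule Hausdorff)
    show "closedin (top_of_set C) {id}"
      using id_C by (simp add: closedin_Hausdorff_singleton[OF Hausdorff])
    show "closedin (top_of_set C) (C - O1)"
      using O1 by (metis Diff_eq closedin_closed_Int closed_Compl)
    fix D assume D: "connectedin (top_of_set C) D"
    then have D': "connectedin (subtopology isometry_topology G) D"
      by (auto simp: sub connectedin_subtopology C_def)
    have "D \<subseteq> {id}" if "id \<in> D"
    proof -
      have "D \<subseteq> connected_component_of_set (subtopology isometry_topology G) id"
        by (rule connected_component_of_maximal[OF D' that])
      also have "\<dots> = {id}"
        using td GD(2) by (simp add: totally_disconnected_def sub)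
      finally show ?thesis .
    qed
    then show "disjnt D {id} \<or> disjnt D (C - O1)"
      using id_O1 by (auto simp: disjnt_iff)
  qed
  then obtain U V where U: "openin (top_of_set C) U" and V: "openin (top_of_set C) V"
    and UV: "U \<union> V = C" "disjnt U V" "id \<in> U" "C - O1 \<subseteq> V"
    by (auto simp: separated_between_def)
  have U_eq: "U = C - V"
    using UV(1,2) by (auto simp: disjnt_iff)
  then have "closedin (top_of_set C) U"
    using V by (metis closedin_diff closedin_topspace topspace_euclidean_subtopology)
  then have U_compact: "compact U"
    using C closedin_compact by blast
  have U_O1: "U \<subseteq> O1"
    using UV by (auto simp: disjnt_iff)
  have UG: "U \<subseteq> G"
    using U_eq by (auto simp: C_def)
  obtain A where A: "open A" "U = C \<inter> A"
    using U by (auto simp: openin_open)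
  \<comment> \<open>\<open>U\<close> was found inside \<open>C\<close> but is open in
    \<open>G\<close>, because elements of \<open>G\<close> in \<open>O1\<close> lie in
    \<open>C\<close>.\<close>
  have U_open: "g \<in> U" if "g \<in> G" "g \<in> A \<inter> O1" for g
    using that A(2) by (auto simp: C_def O1_def)
  have "\<exists>p. finite (fst p) \<and> snd p > 0 \<and> {h. \<forall>y\<in>fst p. dist (u y) (h y) < snd p} \<subseteq> A \<inter> O1"
    if "u \<in> U" for u
  proof -
    have "u \<in> A \<inter> O1"
      using that A(2) U_O1 by blast
    from open_fun_contains_nbhd[OF open_Int[OF A(1) O1] this] show ?thesis
      by simp
  qed
  then obtain p where p: "\<forall>u\<in>U. finite (fst (p u)) \<and> snd (p u) > 0 \<and>
      {h. \<forall>y\<in>fst (p u). dist (u y) (h y) < snd (p u)} \<subseteq> A \<inter> O1"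
    using bchoice[of U "\<lambda>u p. finite (fst p) \<and> snd p > 0 \<and>
      {h. \<forall>y\<in>fst p. dist (u y) (h y) < snd p} \<subseteq> A \<inter> O1"] by blast
  define F e where "F u = fst (p u)" and "e u = snd (p u)" for u
  have F: "finite (F u)" and e: "e u > 0"
    and FA: "{h. \<forall>y\<in>F u. dist (u y) (h y) < e u} \<subseteq> A \<inter> O1" if "u \<in> U" for u
    using p that by (simp_all add: F_def e_def)
  \<comment> \<open>Half the radius leaves room for the triangle inequality, so that a finite
    subcover yields one \<open>F'\<close> and one \<open>d\<close> valid at all points of
    \<open>U\<close>.\<close>
  define nb where "nb u = {h. \<forall>y\<in>F u. dist (u y) (h y) < e u / 2}" for u
  have nb_open: "open (nb u)" if "u \<in> U" for u
    unfolding nb_def by (rule open_fun_nbhd[OF F[OF that]])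
  have U_cover: "U \<subseteq> (\<Union>u\<in>U. nb u)"
    using e by (force simp: nb_def)
  have "\<exists>N\<subseteq>U. finite N \<and> U \<subseteq> (\<Union>u\<in>N. nb u)"
    by (rule compactE_image[OF U_compact nb_open U_cover]) auto
  then obtain N where N: "N \<subseteq> U" "finite N" and UN: "U \<subseteq> (\<Union>u\<in>N. nb u)"
    by blast
  define F' where "F' = (\<Union>u\<in>N. F u)"
  define d where "d = Min (insert 1 ((\<lambda>u. e u / 2) ` N))"
  have F': "finite F'"
    using N F by (auto simp: F'_def)
  have d0: "d > 0"
    using N e by (auto simp: d_def)
  have d: "d \<le> e u / 2" if "u \<in> N" for u
    unfolding d_def using that N(2) by (intro Min_le) auto
  have U_close: "h \<in> U" if u: "u \<in> U" and h: "h \<in> G" "\<And>y. y \<in> F' \<Longrightarrow> dist (u y) (h y) < d" for u h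
  proof -
    obtain v where v: "v \<in> N" "\<And>y. y \<in> F v \<Longrightarrow> dist (v y) (u y) < e v / 2"
      using UN u by (auto simp: nb_def)
    have "dist (v y) (h y) < e v" if "y \<in> F v" for y
      using v(2)[OF that] h(2)[of y] d[OF v(1)] that v(1) dist_triangle[of "v y" "h y" "u y"]
      by (force simp: F'_def)
    then show ?thesis
      using FA[of v] v(1) N(1) U_open[OF h(1)] by blast
  qed
  \<comment> \<open>The condition on the inverse makes \<open>Q\<close> closed under
    inverses.\<close>
  define Q where "Q = {g \<in> G. \<forall>u\<in>U. u \<circ> g \<in> U \<and> u \<circ> inv_into UNIV g \<in> U}"
  have inv_inv: "inv_into UNIV (inv_into UNIV g) = g" if "g \<in> G" for g
    using isometryD(1) GD(1) that by (metis inv_inv_eq subsetD)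
  have inv_comp: "inv_into UNIV (g \<circ> h) = inv_into UNIV h \<circ> inv_into UNIV g" if "g \<in> G" "h \<in> G" for g h
    using isometryD(1) GD(1) that by (metis o_inv_distrib subsetD)
  have Q: "subgroup Q isometry_group"
  proof (rule group.subgroupI[OF group_isometry_group])
    show "Q \<subseteq> carrier isometry_group"
      using GD(1) by (auto simp: Q_def)
    show "Q \<noteq> {}"
      using GD(2) by (auto simp: Q_def intro!: exI[of _ id])
    fix g assume g: "g \<in> Q"
    then have gG: "g \<in> G"
      by (simp add: Q_def)
    then show "m_inv isometry_group g \<in> Q"
      using g GD inv_isometry_group(1)[of g] inv_inv by (auto simp: Q_def)
    fix h assume h: "h \<in> Q"
    then have hG: "h \<in> G"
      by (simp add: Q_def)
    have "g \<circ> h \<in> Q"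
      using g h GD(3)[OF gG hG] inv_comp[OF gG hG] by (simp add: Q_def flip: o_assoc) (simp add: o_assoc)
    then show "g \<otimes>\<^bsub>isometry_group\<^esub> h \<in> Q"
      by (simp add: isometry_group_def)
  qed
  have small: "dist (q y) y \<le> 1 / 2" if q: "q \<in> Q" and y: "y \<in> cball x (R + 1)" for q y
  proof -
    have "q \<in> U"
      using q UV(3) by (force simp: Q_def)
    then have "\<forall>y\<in>F0. dist (id y) (q y) < 1 / 4" and "q \<in> G"
      using U_O1 UG by (auto simp: O1_def)
    then have "dist (id y) (q y) < 1 / 2"
      using F0_close[of id q] iso y by simp
    then show ?thesis
      by (simp add: dist_commute)
  qed
  have fix_ball: "q y = y" if "q \<in> Q" "y \<in> cball x R" for q y
    by (rule small_isometries_fix_ball[OF proper cat complete Q _ that]) (erule (1) small)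
  have "g \<in> Q" if g: "g \<in> G" and close: "\<And>y. y \<in> F' \<Longrightarrow> dist y (g y) < d" for g
  proof -
    have "u \<circ> g \<in> U" "u \<circ> inv_into UNIV g \<in> U" if u: "u \<in> U" for u
    proof -
      have uG: "u \<in> G"
        using u UG by blast
      \<comment> \<open>Since \<open>u\<close> is an isometry, \<open>u \<circ> g\<close> is as
        close to \<open>u\<close> as \<open>g\<close> is to the identity, uniformly in
        \<open>u\<close>.\<close>
      show "u \<circ> g \<in> U"
        using close by (intro U_close[OF u] GD uG g) (simp add: iso[OF uG])
      have "dist y (inv_into UNIV g y) = dist y (g y)" for y
        using dist_isometry_inv[of g y y] GD(1) g by (metis dist_commute subsetD)
      then show "u \<circ> inv_into UNIV g \<in> U"
        using close by (intro U_close[OF u] GD uG g) (simp add: iso[OF uG])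
    qed
    then show "g \<in> Q"
      using g by (simp add: Q_def)
  qed
  then have "\<forall>g\<in>G. (\<forall>y\<in>F'. dist y (g y) < d) \<longrightarrow> (\<forall>y\<in>cball x R. g y = y)"
    using fix_ball by blast
  with F' d0 show ?thesis
    by (intro exI[of _ F'] exI[of _ d] conjI)
qed

text \<open>A limit \<open>g\<close> of elements \<open>g'\<close> agrees with them on large balls. As the ray from \<open>p\<close> to \<open>g\<xi>\<close> is the
  image of the ray from \<open>g\<^sup>-\<^sup>1p\<close> to \<open>\<xi>\<close>, the angles at \<open>p\<close> between \<open>\<zeta>\<close> and \<open>g\<xi>\<close> resp. \<open>g'\<xi>\<close> then
  coincide.\<close>

lemma tits_limit_of_orbit:
  fixes x :: "'a::metric_space" and G :: "('a \<Rightarrow> 'a) set"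
  assumes proper: "proper_space TYPE('a)" and cat: "CAT0_space TYPE('a)"
    and complete: "geodesically_complete TYPE('a)"
    and G: "subgroup G isometry_group" and G_closed: "closedin isometry_topology G"
    and td: "totally_disconnected (subtopology isometry_topology G)"
    and b: "\<xi> \<in> boundary" "\<zeta> \<in> boundary"
    and S: "S \<subseteq> G" "\<forall>g\<in>S. dist x (g x) \<le> D"
    and near: "\<forall>e>0. \<exists>g\<in>S. tits_angle \<zeta> (boundary_action g \<xi>) < e"
  shows "\<exists>g\<in>G. boundary_action g \<xi> = \<zeta> \<and> (\<forall>R. \<forall>e>0. \<exists>g'\<in>S.
    tits_angle \<zeta> (boundary_action g' \<xi>) < e \<and> (\<forall>y\<in>cball x R. g' y = g y))"
proof -
  note GD = isometry_subgroupD[OF G]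
  have Gi: "g \<in> carrier isometry_group" if "g \<in> G" for g
    using GD(1) that by blast
  have "\<exists>g\<in>S. tits_angle \<zeta> (boundary_action g \<xi>) < 1 / (real n + 1)" for n
    by (rule near[rule_format]) simp
  then obtain g where gS: "\<And>n. g n \<in> S"
    and g_tits: "\<And>n. tits_angle \<zeta> (boundary_action (g n) \<xi>) < 1 / (real n + 1)"
    by metis
  have "compact {g \<in> G. dist x (g x) \<le> D}"
    by (rule compact_isometries[OF proper G_closed])
  from compact_cluster_point[OF this, of g] obtain l where l: "l \<in> G"
    and cl: "\<And>U. open U \<Longrightarrow> l \<in> U \<Longrightarrow> \<exists>\<^sub>F n in sequentially. g n \<in> U"
    using gS S by blast
  have li: "l \<in> carrier isometry_group"
    by (rule Gi[OF l])
  \<comment> \<open>If \<open>g n\<close> is close to \<open>l\<close> on \<open>F\<close>, then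
    \<open>inv_into UNIV l \<circ> g n\<close> is close to the identity there and so fixes the whole
    ball.\<close>
  have agree: "\<exists>\<^sub>F n in sequentially. \<forall>y\<in>cball x R. g n y = l y" for R
  proof -
    obtain F e where F: "finite F" "e > 0"
      and FR: "\<And>h. h \<in> G \<Longrightarrow> (\<forall>y\<in>F. dist y (h y) < e) \<Longrightarrow> (\<forall>y\<in>cball x R. h y = y)"
      using pointwise_stabilizer_ball_open[OF proper cat complete G G_closed td, of x R] by blast
    have "\<exists>\<^sub>F n in sequentially. g n \<in> {h. \<forall>y\<in>F. dist (l y) (h y) < e}"
      using F by (intro cl open_fun_nbhd) auto
    then show ?thesis
    proof (rule frequently_elim1)
      fix n assume n: "g n \<in> {h. \<forall>y\<in>F. dist (l y) (h y) < e}"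
      have "inv_into UNIV l \<circ> g n \<in> G"
        using l gS S(1) by (intro GD) auto
      moreover have "\<forall>y\<in>F. dist y ((inv_into UNIV l \<circ> g n) y) < e"
        using n dist_isometry_inv[OF li] by (simp add: dist_commute)
      ultimately have "\<forall>y\<in>cball x R. (inv_into UNIV l \<circ> g n) y = y"
        using FR by blast
      then show "\<forall>y\<in>cball x R. g n y = l y"
        using isometry_inv(1)[OF li] by (metis comp_apply)
    qed
  qed
  have agree_late: "\<exists>n\<ge>N. \<forall>y\<in>cball x R. g n y = l y" for N R
    using agree[of R] by (auto simp: frequently_sequentially)
  have small: "\<exists>N. \<forall>n\<ge>N. 1 / (real n + 1) < e" if "e > 0" for e :: real
  proof -
    obtain N where N: "1 / e < real N"
      using reals_Archimedean2 by blast
    have "1 / (real n + 1) < e" if "n \<ge> N" for n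
    proof -
      have "real N \<le> real n"
        using that by simp
      then have "1 / e < real n + 1"
        using N by simp
      then show ?thesis
        using \<open>e > 0\<close> by (simp add: field_simps)
    qed
    then show ?thesis
      by blast
  qed
  have "angle_at p \<zeta> (boundary_action l \<xi>) = 0" for p
  proof (rule antisym)
    define q where "q = inv_into UNIV l p"
    have lq: "l q = p"
      by (simp add: q_def isometry_inv[OF li])
    show "0 \<le> angle_at p \<zeta> (boundary_action l \<xi>)"
      by (rule angle_at_bounds[OF proper cat b(2) boundary_action_closed[OF li b(1)]])
    have "angle_at p \<zeta> (boundary_action l \<xi>) \<le> 0 + e" if e: "e > 0" for e
    proof -
      obtain N where N: "\<And>n. n \<ge> N \<Longrightarrow> 1 / (real n + 1) < e"
        using small[OF e] by blast
      \<comment> \<open>This ball contains the first unit of the ray from \<open>q\<close> to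
        \<open>\<xi>\<close>, which determines the angle at \<open>p\<close> with the image of
        \<open>\<xi>\<close>.\<close>
      obtain n where n: "n \<ge> N" "\<And>y. y \<in> cball x (dist x q + 1) \<Longrightarrow> g n y = l y"
        using agree_late by blast
      have gi: "g n \<in> carrier isometry_group"
        using gS S(1) Gi by blast
      have gq: "g n q = p"
        using n(2)[of q] lq by simp
      have "alexandrov_angle (ray_from_to p \<zeta>) (ray_from_to p (boundary_action l \<xi>)) =
        alexandrov_angle (ray_from_to p \<zeta>) (ray_from_to p (boundary_action (g n) \<xi>))"
      proof (rule alexandrov_angle_local[of 1])
        fix t :: real assume t: "0 \<le> t" "t \<le> 1"
        define z where "z = ray_from_to q \<xi> t"
        have "dist q z \<le> 1"
          using ray_from_to[OF proper cat b(1), of q] boundary_rays[OF b(1)] t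
            geodesic_raysD[of "ray_from_to q \<xi>" 0 t] by (auto simp: z_def)
        then have "g n z = l z"
          using dist_triangle[of x z q] by (intro n) auto
        then show "ray_from_to p (boundary_action l \<xi>) t = ray_from_to p (boundary_action (g n) \<xi>) t"
          using ray_from_to_isometry[OF proper cat li b(1) t(1), of q]
            ray_from_to_isometry[OF proper cat gi b(1) t(1), of q] lq gq by (simp add: z_def)
      qed auto
      then have "angle_at p \<zeta> (boundary_action l \<xi>) = angle_at p \<zeta> (boundary_action (g n) \<xi>)"
        by (simp add: angle_at_def)
      also have "\<dots> \<le> tits_angle \<zeta> (boundary_action (g n) \<xi>)"
        by (rule angle_at_bounds[OF proper cat b(2) boundary_action_closed[OF gi b(1)]])
      also have "\<dots> \<le> e"
        using g_tits[of n] N[OF n(1)] by simp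
      finally show ?thesis
        by simp
    qed
    then show "angle_at p \<zeta> (boundary_action l \<xi>) \<le> 0"
      by (rule field_le_epsilon)
  qed
  then have "boundary_action l \<xi> = \<zeta>"
    using angle_at_eq_0_imp_eq[OF proper cat b(2) boundary_action_closed[OF li b(1)]] by simp
  moreover have "\<exists>g'\<in>S. tits_angle \<zeta> (boundary_action g' \<xi>) < e \<and> (\<forall>y\<in>cball x R. g' y = l y)"
    if e: "e > 0" for R e
  proof -
    obtain N where N: "\<And>n. n \<ge> N \<Longrightarrow> 1 / (real n + 1) < e"
      using small[OF e] by blast
    obtain n where "n \<ge> N" "\<forall>y\<in>cball x R. g n y = l y"
      using agree_late by blast
    then show ?thesis
      using N[of n] g_tits[of n] gS[of n] by (intro bexI[of _ "g n"]) auto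
  qed
  ultimately show ?thesis
    using l by blast
qed

section \<open>Discreteness of the orbit\<close>

text \<open>Two limits are taken. The first puts \<open>\<zeta>\<close> into the orbit and, after
  translation, leaves accumulation at \<open>\<xi>\<close>; the second is taken after moving branch
  points into a fixed ball.\<close>

lemma orbit_tits_isolated:
  fixes G :: "('a::metric_space \<Rightarrow> 'a) set" and \<xi> \<zeta> :: "(real \<Rightarrow> 'a) set"
  assumes proper: "proper_space TYPE('a)" and cat: "CAT0_space TYPE('a)"
    and complete: "geodesically_complete TYPE('a)"
    and G: "subgroup G isometry_group" and G_closed: "closedin isometry_topology G"
    and td: "totally_disconnected (subtopology isometry_topology G)"
    and b: "\<xi> \<in> boundary" "\<zeta> \<in> boundary"
    and cocompact: "acts_cocompactly {g \<in> G. boundary_action g \<xi> = \<xi>}"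
  shows "\<exists>e>0. \<forall>g\<in>G. tits_angle \<zeta> (boundary_action g \<xi>) < e \<longrightarrow> boundary_action g \<xi> = \<zeta>"
proof (rule ccontr)
  assume "\<not> ?thesis"
  then have far: "\<exists>g\<in>G. tits_angle \<zeta> (boundary_action g \<xi>) < e \<and> boundary_action g \<xi> \<noteq> \<zeta>" if "e > 0" for e
    using that by blast
  note GD = isometry_subgroupD[OF G]
  have Gi: "g \<in> carrier isometry_group" if "g \<in> G" for g
    using GD(1) that by blast
  note limit = tits_limit_of_orbit[OF proper cat complete G G_closed td b(1)]
  define H where "H = {g \<in> G. boundary_action g \<xi> = \<xi>}"
  define x :: 'a where "x = undefined"
  obtain K where K: "compact K" "(\<Union>g\<in>H. g ` K) = UNIV"
    using cocompact by (auto simp: acts_cocompactly_def H_def)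
  obtain D where "\<forall>y\<in>K. dist x y \<le> D"
    using compact_imp_bounded[OF K(1)] unfolding bounded_any_center[where a = x] by blast
  then have D: "K \<subseteq> cball x D"
    by auto
  have H_inv: "inv_into UNIV h \<in> H" if "h \<in> H" for h
    using that GD(4)[of h] boundary_action_inv(1)[OF Gi, of h \<xi>] by (auto simp: H_def)
  have move: "\<exists>h\<in>H. dist x (h y) \<le> D" for y
  proof -
    obtain h k where h: "h \<in> H" "k \<in> K" "y = h k"
      using K(2) by blast
    then have "inv_into UNIV h y = k"
      using isometry_inv(2)[OF Gi, of h] by (simp add: H_def)
    then show ?thesis
      using H_inv[OF h(1)] h(2) D by force
  qed
  define S where "S = {g \<in> G. dist x (g x) \<le> D \<and> boundary_action g \<xi> \<noteq> \<zeta>}"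
  have S_near: "\<exists>g\<in>S. tits_angle \<zeta> (boundary_action g \<xi>) < e" if e: "e > 0" for e
  proof -
    obtain g where g: "g \<in> G" "tits_angle \<zeta> (boundary_action g \<xi>) < e" "boundary_action g \<xi> \<noteq> \<zeta>"
      using far[OF e] by blast
    obtain h where h: "h \<in> H" "dist x (h (inv_into UNIV g x)) \<le> D"
      using move by blast
    \<comment> \<open>Precomposition with an element of the stabiliser keeps the image of
      \<open>\<xi>\<close> and brings the displacement of \<open>x\<close> below
      \<open>D\<close>.\<close>
    define g' where "g' = g \<circ> inv_into UNIV h"
    have "dist x (g' x) = dist x (h (inv_into UNIV g x))"
      using dist_isometry_inv[OF Gi[OF g(1)]] dist_isometry_inv[OF Gi, of h] h(1)
      by (simp add: g'_def H_def) (metis dist_commute)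
    moreover have "boundary_action g' \<xi> = boundary_action g \<xi>"
      using H_inv[OF h(1)] by (simp add: g'_def boundary_action_comp H_def)
    moreover have "g' \<in> G"
      unfolding g'_def using H_inv[OF h(1)] by (intro GD(3) g) (simp add: H_def)
    ultimately show ?thesis
      using g h(2) by (intro bexI[of _ g']) (auto simp: S_def)
  qed
  have "S \<subseteq> G" and "\<forall>g\<in>S. dist x (g x) \<le> D"
    by (auto simp: S_def)
  from limit[OF b(2) this] S_near obtain g1 where g1: "g1 \<in> G" "boundary_action g1 \<xi> = \<zeta>"
    and g1_near: "\<forall>R. \<forall>e>0. \<exists>g'\<in>S. tits_angle \<zeta> (boundary_action g' \<xi>) < e \<and>
      (\<forall>y\<in>cball x R. g' y = g1 y)"
    by blast
  \<comment> \<open>The bounds on \<open>q\<close> and \<open>t\<close> keep the branching inside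
    \<open>cball x (D + 1)\<close>, where the second limit controls it.\<close>
  define S' where "S' = {h \<in> G. \<exists>q. dist x q \<le> D \<and> h q = q \<and>
    (\<exists>t. 0 \<le> t \<and> t \<le> 1 \<and> h (ray_from_to q \<xi> t) \<noteq> ray_from_to q \<xi> t)}"
  have S'_near: "\<exists>h\<in>S'. tits_angle \<xi> (boundary_action h \<xi>) < e" if e: "e > 0" for e
  proof -
    \<comment> \<open>Radius 0 suffices: agreement of \<open>g'\<close> and \<open>g1\<close> at
      \<open>x\<close> makes \<open>h\<close> fix \<open>x\<close>.\<close>
    obtain g' where g': "g' \<in> S" "tits_angle \<zeta> (boundary_action g' \<xi>) < e"
      "\<forall>y\<in>cball x 0. g' y = g1 y"
      using g1_near e by blast
    define h where "h = inv_into UNIV g1 \<circ> g'"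
    have h: "h \<in> G"
      unfolding h_def using g'(1) by (intro GD g1) (simp add: S_def)
    have g1h: "boundary_action g1 (boundary_action h \<xi>) = boundary_action g' \<xi>"
      unfolding h_def boundary_action_comp by (rule boundary_action_inv(2)[OF Gi[OF g1(1)]])
    have hx: "h x = x"
      using g'(3) isometry_inv(2)[OF Gi[OF g1(1)]] by (simp add: h_def)
    have h\<xi>: "boundary_action h \<xi> \<noteq> \<xi>"
      using g1h g1(2) g'(1) by (auto simp: S_def)
    have h_tits: "tits_angle \<xi> (boundary_action h \<xi>) < e"
      using tits_angle_isometry[OF proper cat Gi[OF g1(1)] b(1) boundary_action_closed[OF Gi[OF h] b(1)]]
        g'(2) g1(2) g1h by simp
    define c where "c = ray_from_to x \<xi>"
    have c: "c \<in> \<xi>" "c 0 = x"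
      unfolding c_def by (rule ray_from_to[OF proper cat b(1)])+
    \<comment> \<open>Integer steps locate the branching: if \<open>P n\<close> holds and
      \<open>P (Suc n)\<close> fails, \<open>h\<close> fixes \<open>c n\<close> and leaves the ray
      within unit length beyond it.\<close>
    define P where "P n \<longleftrightarrow> (\<forall>t. 0 \<le> t \<and> t \<le> real n \<longrightarrow> h (c t) = c t)" for n
    have "\<not> (\<forall>n. P n)"
    proof
      assume "\<forall>n. P n"
      then have "h (c t) = c t" if "t \<ge> 0" for t
        using that real_arch_simple[of t] by (auto simp: P_def)
      moreover have "h \<circ> c \<in> geodesic_rays"
        using boundary_rays[OF b(1) c(1)]
        by (simp add: geodesic_rays_def geodesic_on_def isometryD(2)[OF Gi[OF h]])
      ultimately have "(c, h \<circ> c) \<in> asymptotic"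
        by (intro asymptoticI[of _ _ 0] boundary_rays[OF b(1) c(1)]) auto
      then have "h \<circ> c \<in> \<xi>"
        using boundary_mem_iff[OF b(1) c(1)] by blast
      moreover have "h \<circ> c \<in> boundary_action h \<xi>"
        using c(1) by (auto simp: boundary_action_def)
      ultimately show False
        using boundary_eqI[OF boundary_action_closed[OF Gi[OF h] b(1)] b(1)] h\<xi> by blast
    qed
    moreover have "P 0"
      unfolding P_def using c(2) hx by (metis antisym of_nat_0)
    ultimately obtain n where n: "P n" "\<not> P (Suc n)"
      by (metis nat_induct)
    then obtain t where t: "0 \<le> t" "t \<le> real (Suc n)" "h (c t) \<noteq> c t"
      by (auto simp: P_def)
    have tn: "real n \<le> t"
      using n(1) t unfolding P_def by (meson linear)
    obtain k where k: "k \<in> H" "dist x (k (c n)) \<le> D"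
      using move by blast
    have kG: "k \<in> G" and k\<xi>: "boundary_action k \<xi> = \<xi>"
      using k(1) by (auto simp: H_def)
    have ray: "ray_from_to (k (c n)) \<xi> (t - n) = k (c t)"
      using ray_from_to_isometry[OF proper cat Gi[OF kG] b(1), of "t - n" "c n"]
        ray_from_to_eq[OF proper cat b(1) boundary_shift[OF b(1) c(1)], of n "t - n"] tn k\<xi> by simp
    \<comment> \<open>Conjugation by \<open>k\<close>, which fixes \<open>\<xi>\<close>, moves the
      fixed point \<open>c n\<close> to within \<open>D\<close> of \<open>x\<close> and preserves
      the Tits angle with \<open>\<xi>\<close>.\<close>
    define h' where "h' = k \<circ> (h \<circ> inv_into UNIV k)"
    have h'k: "h' (k y) = k (h y)" for y
      by (simp add: h'_def isometry_inv(2)[OF Gi[OF kG]])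
    have "h' (k (c n)) = k (c n)"
      using n(1) by (simp add: h'k P_def)
    moreover have "h' (k (c t)) \<noteq> k (c t)"
      using t(3) isometryD(2)[OF Gi[OF kG], of "h (c t)" "c t"] by (auto simp: h'k)
    moreover have "h' \<in> G"
      unfolding h'_def by (intro GD kG h)
    ultimately have "h' \<in> S'"
      using k(2) t tn unfolding S'_def
      by (intro CollectI conjI exI[of _ "k (c n)"] exI[of _ "t - n"]) (auto simp: ray)
    moreover have "boundary_action h' \<xi> = boundary_action k (boundary_action h \<xi>)"
      using H_inv[OF k(1)] by (simp add: h'_def boundary_action_comp H_def)
    then have "tits_angle \<xi> (boundary_action h' \<xi>) = tits_angle \<xi> (boundary_action h \<xi>)"
      using tits_angle_isometry[OF proper cat Gi[OF kG] b(1) boundary_action_closed[OF Gi[OF h] b(1)]]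
        k\<xi> by simp
    ultimately show ?thesis
      using h_tits by (intro bexI[of _ h']) simp_all
  qed
  have S'_bound: "dist x (h x) \<le> 2 * D" if hS': "h \<in> S'" for h
  proof -
    obtain q where q: "h \<in> G" "dist x q \<le> D" "h q = q"
      using hS' by (auto simp: S'_def)
    then show ?thesis
      using isometryD(2)[OF Gi, of h q x] dist_triangle[of x "h x" q] by (simp add: dist_commute)
  qed
  have "S' \<subseteq> G" and "\<forall>h\<in>S'. dist x (h x) \<le> 2 * D"
    using S'_bound by (auto simp: S'_def)
  from limit[OF b(1) this] S'_near obtain g2 where g2: "g2 \<in> G" "boundary_action g2 \<xi> = \<xi>"
    and g2_near: "\<forall>R. \<forall>e>0. \<exists>g'\<in>S'. tits_angle \<xi> (boundary_action g' \<xi>) < e \<and>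
      (\<forall>y\<in>cball x R. g' y = g2 y)"
    by blast
  obtain h where h: "h \<in> S'" "\<forall>y\<in>cball x (D + 1). h y = g2 y"
    using g2_near zero_less_one by blast
  then obtain q t where q: "dist x q \<le> D" "h q = q" and t: "0 \<le> t" "t \<le> 1"
    and neq: "h (ray_from_to q \<xi> t) \<noteq> ray_from_to q \<xi> t"
    by (auto simp: S'_def)
  have "g2 q = q"
    using h(2)[rule_format, of q] q by simp
  \<comment> \<open>\<open>g2\<close> fixes both the origin \<open>q\<close> and the endpoint
    \<open>\<xi>\<close>, hence the whole ray, whereas \<open>h\<close>, which agrees with
    \<open>g2\<close> near \<open>q\<close>, was chosen to move a point of it.\<close>
  then have "g2 (ray_from_to q \<xi> t) = ray_from_to q \<xi> t"
    using ray_from_to_isometry[OF proper cat Gi[OF g2(1)] b(1) t(1), of q] g2(2) by simp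
  moreover have "dist q (ray_from_to q \<xi> t) \<le> 1"
    using ray_from_to[OF proper cat b(1), of q] boundary_rays[OF b(1)] t
      geodesic_raysD[of "ray_from_to q \<xi>" 0 t] by auto
  then have "h (ray_from_to q \<xi> t) = g2 (ray_from_to q \<xi> t)"
    using q(1) dist_triangle[of x "ray_from_to q \<xi> t" q] by (intro h(2)[rule_format]) simp
  ultimately show False
    using neq by simp
qed

lemma topspace_tits_topology: "topspace tits_topology = boundary"
proof -
  have "openin tits_topology boundary"
    unfolding openin_tits_topology by (auto intro: exI[of _ 1])
  then show ?thesis
    by (metis openin_subset openin_tits_topology openin_topspace subset_antisym)
qed

theorem proposition7p15:
  fixes G :: "('a::metric_space \<Rightarrow> 'a) set" and \<xi> :: "(real \<Rightarrow> 'a) set"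
  assumes "proper_space TYPE('a)"
    and "CAT0_space TYPE('a)"
    and "geodesically_complete TYPE('a)"
    and "subgroup G isometry_group"
    and "closedin isometry_topology G"
    and "totally_disconnected (subtopology isometry_topology G)"
    and "\<xi> \<in> boundary"
    and "acts_cocompactly (stabilizer (isometry_group\<lparr>carrier := G\<rparr>) boundary_action \<xi>)"
  shows "subtopology tits_topology (orbit (isometry_group\<lparr>carrier := G\<rparr>) boundary_action \<xi>) =
    discrete_topology (orbit (isometry_group\<lparr>carrier := G\<rparr>) boundary_action \<xi>)"
proof -
  define \<Omega> where "\<Omega> = orbit (isometry_group\<lparr>carrier := G\<rparr>) boundary_action \<xi>"
  have \<Omega>: "\<Omega> = {boundary_action g \<xi> | g. g \<in> G}"
    by (simp add: \<Omega>_def orbit_def)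
  have sub: "\<Omega> \<subseteq> boundary"
    using boundary_action_closed[OF _ assms(7)] isometry_subgroupD(1)[OF assms(4)] by (auto simp: \<Omega>)
  have isolated: "\<exists>e>0. \<forall>\<eta>\<in>\<Omega>. tits_angle \<zeta> \<eta> < e \<longrightarrow> \<eta> = \<zeta>" if "\<zeta> \<in> boundary" for \<zeta>
    using orbit_tits_isolated[OF assms(1-7) that] assms(8) by (auto simp: \<Omega> stabilizer_def)
  have "openin (subtopology tits_topology \<Omega>) {\<eta>}" if \<eta>: "\<eta> \<in> \<Omega>" for \<eta>
  proof -
    \<comment> \<open>Openness asks for a margin at every point of this set, also at boundary points
      outside the orbit; hence \<open>isolated\<close> is stated for all \<open>\<zeta>\<close> in
      the boundary.\<close>
    have "openin tits_topology (boundary - (\<Omega> - {\<eta>}))"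
      unfolding openin_tits_topology using isolated by (fastforce simp: Ball_def)
    moreover have "{\<eta>} = (boundary - (\<Omega> - {\<eta>})) \<inter> \<Omega>"
      using \<eta> sub by auto
    ultimately show ?thesis
      by (auto simp: openin_subtopology)
  qed
  then have "discrete_topology \<Omega> = subtopology tits_topology \<Omega>"
    using sub by (simp add: discrete_topology_unique topspace_tits_topology inf.absorb2)
  then show ?thesis
    by (simp add: \<Omega>_def)
qed

end
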